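(* Let $\mu>0$ and $J_m>0$ be constants and let $W_{\mathrm G}:=-\frac{\mu}{2}J_m\ln\left(1-\frac{I_1-3}{J_m}\right)$, where $I_1:=\operatorname{tr}\mathbf C_f$ is assumed to satisfy $I_1<J_m+3$ everywhere on $\overline S\times[-h,h]$. Let $\phi$ be of class $\mathcal C^3$ in $x_3$, with $\phi(\boldsymbol x,0)=0$ and $\phi'(\boldsymbol x,0)>0$, and suppose that $\det\mathbf C=1$ on $\overline S$ and $\det\mathbf C_f=1$ on $\overline S\times[-h,h]$, so that $\phi$ can be expressed as $$\phi(\boldsymbol x,x_3)=x_3-H(\boldsymbol x)x_3^2+\tfrac13\left(6H(\boldsymbol x)^2-K(\boldsymbol x)\right)x_3^3+O(x_3^4).$$ Then, for all $\boldsymbol x\in\overline S$, as $h\to0$, $$w_{\mathrm G}(\boldsymbol x):=\int_{-h}^{h}W_{\mathrm G}(\boldsymbol x,x_3)\,\mathrm dx_3=h\,w_s(\boldsymbol x)+h^3\,w_b(\boldsymbol x)+O(h^5),$$ where $$w_s=-\mu J_m\ln\left(1-\frac{\operatorname{tr}\mathbf C-2}{J_m}\right),$$ $$w_b=\frac{\mu}{3}J_m\left[2\left(\frac{\operatorname{tr}(\mathbf B\nabla_{\!\mathrm s}\boldsymbol\nu)-2H}{J_m-(\operatorname{tr}\mathbf C-2)}\right)^2+\frac{16H^2-K(\operatorname{tr}\mathbf C+2)}{J_m-(\operatorname{tr}\mathbf C-2)}\right],$$ all quantities being evaluated at $\boldsymbol x$.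
   Context: $S$ is a bounded flat two-dimensional domain in the plane orthogonal to the unit vector $\boldsymbol e_3$ in three-dimensional Euclidean space, and $h>0$. $\boldsymbol y$ is an injective $\mathcal C^3$-immersion of $\overline S$ into three-dimensional space, $\mathscr S=\boldsymbol y(S)$, and $\boldsymbol\nu$ is the unit normal to $\mathscr S$, viewed as a function on $\overline S$ and oriented so that $\boldsymbol\nu=\partial_1\boldsymbol y\times\partial_2\boldsymbol y/|\partial_1\boldsymbol y\times\partial_2\boldsymbol y|$. $\nabla$ is the gradient in the planar variable $\boldsymbol x$; a prime denotes $\partial/\partial x_3$. $\phi:\overline S\times[-h,h]\to\mathbb R$ is a scalar function (the plate deformation is $\boldsymbol y(\boldsymbol x)+\phi(\boldsymbol x,x_3)\boldsymbol\nu(\boldsymbol x)$, and the term containing $\nabla\phi$ is neglected in its gradient). By definition $$\mathbf C_f:=\mathbf C_\phi+\phi'^2\boldsymbol e_3\otimes\boldsymbol e_3,\quad \mathbf C_\phi:=\mathbf C+\phi\mathbf C_1+\phi^2\mathbf C_2,$$ $$\mathbf C:=(\nabla\boldsymbol y)^{\mathsf T}(\nabla\boldsymbol y),\quad \mathbf C_1:=(\nabla\boldsymbol y)^{\mathsf T}(\nabla\boldsymbol\nu)+(\nabla\boldsymbol\nu)^{\mathsf T}(\nabla\boldsymbol y),\quad \mathbf C_2:=(\nabla\boldsymbol\nu)^{\mathsf T}(\nabla\boldsymbol\nu),$$ where $\mathbf C,\mathbf C_1,\mathbf C_2$ act on the two-dimensional space $\boldsymbol e_3^\perp$ (so $\det\mathbf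 C$ is a $2\times2$ determinant, while $\mathbf C_f$ acts on three-dimensional space). $\mathbf B:=(\nabla\boldsymbol y)(\nabla\boldsymbol y)^{\mathsf T}$ acts on the tangent plane $\boldsymbol\nu^\perp$. $\nabla_{\!\mathrm s}\boldsymbol\nu=(\nabla\boldsymbol\nu)(\nabla\boldsymbol y)^{-1}$ is the (symmetric) curvature tensor of $\mathscr S$ on $\boldsymbol\nu^\perp$, with $\nabla\boldsymbol y$ regarded as an invertible map $\boldsymbol e_3^\perp\to\boldsymbol\nu^\perp$; $H:=\frac12\operatorname{tr}(\nabla_{\!\mathrm s}\boldsymbol\nu)$ and $K:=\det(\nabla_{\!\mathrm s}\boldsymbol\nu)$ are the mean and Gaussian curvatures. The function $\phi$ is fixed (independent of $h$) as $h\to0$. *)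

theory Defs
  imports "HOL-Analysis.Analysis" "HOL-Library.Landau_Symbols"
begin

(* The plane orthogonal to e_3 is identified with real^2 through the orthonormal basis e_1, e_2;
   linear maps from it to three-dimensional space are matrices of type real^2^3
   (3 rows, 2 columns). *)

section \<open>Regularity up to the boundary\<close>

(* Class C^k on the closure of the open set S: f is continuous on the closure, and the partial
   derivatives up to order k exist in S and extend continuously to the closure.
   At each level, g is such an extension of the i-th partial derivative. *)
primrec Ck_closure ::
  "nat \<Rightarrow> (real^2) set \<Rightarrow> (real^2 \<Rightarrow> real^3) \<Rightarrow> bool" where
  "Ck_closure 0 S f \<longleftrightarrow> continuous_on (closure S) f"
| "Ck_closure (Suc k) S f \<longleftrightarrow>
     continuous_on (closure S) f \<and>
     (\<forall>x\<in>S. f differentiable (at x)) \<and>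
     (\<forall>i. \<exists>g. Ck_closure k S g \<and>
        (\<forall>x\<in>S. g x = frechet_derivative f (at x) (axis i 1)))"

(* Class C^k on a nondegenerate interval, with one-sided derivatives at its end points. *)
primrec Ck_interval :: "nat \<Rightarrow> real set \<Rightarrow> (real \<Rightarrow> real) \<Rightarrow> bool" where
  "Ck_interval 0 A f \<longleftrightarrow> continuous_on A f"
| "Ck_interval (Suc k) A f \<longleftrightarrow>
     (\<exists>g. (\<forall>t\<in>A. (f has_real_derivative g t) (at t within A)) \<and> Ck_interval k A g)"

(* The gradient as a function on the closure of S: at boundary points it is the continuous
   extension of the Jacobian matrix from within S. *)
definition grad :: "(real^2) set \<Rightarrow> (real^2 \<Rightarrow> real^3) \<Rightarrow> real^2 \<Rightarrow> real^2^3" where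
  "grad S f x =
     (if x \<in> S then jacobian f (at x) else Lim (at x within S) (\<lambda>z. jacobian f (at z)))"

definition C3_immersion_closure :: "(real^2) set \<Rightarrow> (real^2 \<Rightarrow> real^3) \<Rightarrow> bool" where
  "C3_immersion_closure S y \<longleftrightarrow>
     Ck_closure 3 S y \<and> (\<forall>x\<in>closure S. inj (\<lambda>v. grad S y x *v v))"

section \<open>Trace and determinant of endomorphisms of a plane in space\<close>

(* The matrix of an endomorphism L of the plane V with respect to some orthonormal basis of V
   (the columns of U). Trace and determinant do not depend on the basis. *)
definition plane_matrix :: "(real^3) set \<Rightarrow> (real^3 \<Rightarrow> real^3) \<Rightarrow> real^2^2" where
  "plane_matrix V L =
     (let U = (SOME U :: real^2^3.
                 transpose U ** U = mat 1 \<and> span {column 1 U, column 2 U} = V)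
      in \<chi> i j. column i U \<bullet> L (column j U))"

definition plane_trace :: "(real^3) set \<Rightarrow> (real^3 \<Rightarrow> real^3) \<Rightarrow> real" where
  "plane_trace V L = trace (plane_matrix V L)"

definition plane_det :: "(real^3) set \<Rightarrow> (real^3 \<Rightarrow> real^3) \<Rightarrow> real" where
  "plane_det V L = det (plane_matrix V L)"

section \<open>Geometry of the surface\<close>

definition unit_normal :: "(real^2) set \<Rightarrow> (real^2 \<Rightarrow> real^3) \<Rightarrow> real^2 \<Rightarrow> real^3" where
  "unit_normal S y x =
     (let c = cross3 (column 1 (grad S y x)) (column 2 (grad S y x)) in (1 / norm c) *\<^sub>R c)"

definition tangent_plane :: "(real^2) set \<Rightarrow> (real^2 \<Rightarrow> real^3) \<Rightarrow> real^2 \<Rightarrow> (real^3) set" where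
  "tangent_plane S y x = orthogonal_comp {unit_normal S y x}"

(* The inverse of the gradient of y is only meaningful on its range, the tangent plane;
   only the values on that plane are used. *)
definition curvature_tensor ::
  "(real^2) set \<Rightarrow> (real^2 \<Rightarrow> real^3) \<Rightarrow> real^2 \<Rightarrow> real^3 \<Rightarrow> real^3" where
  "curvature_tensor S y x w =
     grad S (unit_normal S y) x *v inv (\<lambda>v. grad S y x *v v) w"

definition mean_curvature :: "(real^2) set \<Rightarrow> (real^2 \<Rightarrow> real^3) \<Rightarrow> real^2 \<Rightarrow> real" where
  "mean_curvature S y x = 1/2 * plane_trace (tangent_plane S y x) (curvature_tensor S y x)"

definition gauss_curvature :: "(real^2) set \<Rightarrow> (real^2 \<Rightarrow> real^3) \<Rightarrow> real^2 \<Rightarrow> real" where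
  "gauss_curvature S y x = plane_det (tangent_plane S y x) (curvature_tensor S y x)"

definition B_tensor :: "(real^2) set \<Rightarrow> (real^2 \<Rightarrow> real^3) \<Rightarrow> real^2 \<Rightarrow> real^3 \<Rightarrow> real^3" where
  "B_tensor S y x w = (grad S y x ** transpose (grad S y x)) *v w"

definition tr_B_curv :: "(real^2) set \<Rightarrow> (real^2 \<Rightarrow> real^3) \<Rightarrow> real^2 \<Rightarrow> real" where
  "tr_B_curv S y x =
     plane_trace (tangent_plane S y x) (B_tensor S y x \<circ> curvature_tensor S y x)"

section \<open>Strain measures\<close>

definition C0 :: "(real^2) set \<Rightarrow> (real^2 \<Rightarrow> real^3) \<Rightarrow> real^2 \<Rightarrow> real^2^2" where
  "C0 S y x = transpose (grad S y x) ** grad S y x"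

definition C1 :: "(real^2) set \<Rightarrow> (real^2 \<Rightarrow> real^3) \<Rightarrow> real^2 \<Rightarrow> real^2^2" where
  "C1 S y x = transpose (grad S y x) ** grad S (unit_normal S y) x
            + transpose (grad S (unit_normal S y) x) ** grad S y x"

definition C2 :: "(real^2) set \<Rightarrow> (real^2 \<Rightarrow> real^3) \<Rightarrow> real^2 \<Rightarrow> real^2^2" where
  "C2 S y x = transpose (grad S (unit_normal S y) x) ** grad S (unit_normal S y) x"

definition C_phi ::
  "(real^2) set \<Rightarrow> (real^2 \<Rightarrow> real^3) \<Rightarrow> (real^2 \<Rightarrow> real \<Rightarrow> real) \<Rightarrow> real^2 \<Rightarrow> real \<Rightarrow> real^2^2"
  where
  "C_phi S y \<phi> x t = C0 S y x + \<phi> x t *\<^sub>R C1 S y x + (\<phi> x t)\<^sup>2 *\<^sub>R C2 S y x"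

(* Inclusion of the plane orthogonal to e_3 into space. *)
definition incl :: "real^2^3" where
  "incl = vector [vector [1, 0], vector [0, 1], vector [0, 0]]"

definition tensor_prod :: "real^3 \<Rightarrow> real^3 \<Rightarrow> real^3^3" where
  "tensor_prod a b = (\<chi> i j. a $ i * b $ j)"

definition e3 :: "real^3" where
  "e3 = axis 3 1"

(* Derivative in x_3 on the interval [-h, h], one-sided at the end points. *)
definition deriv3 :: "real \<Rightarrow> (real^2 \<Rightarrow> real \<Rightarrow> real) \<Rightarrow> real^2 \<Rightarrow> real \<Rightarrow> real" where
  "deriv3 h \<phi> x t = vector_derivative (\<phi> x) (at t within {-h..h})"

(* A tensor A on the plane orthogonal to e_3 acts on space as incl ** A ** transpose incl. *)
definition C_f ::
  "(real^2) set \<Rightarrow> (real^2 \<Rightarrow> real^3) \<Rightarrow> real \<Rightarrow> (real^2 \<Rightarrow> real \<Rightarrow> real) \<Rightarrow> real^2 \<Rightarrow> real \<Rightarrow> real^3^3"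
  where
  "C_f S y h \<phi> x t =
     incl ** C_phi S y \<phi> x t ** transpose incl + (deriv3 h \<phi> x t)\<^sup>2 *\<^sub>R tensor_prod e3 e3"

section \<open>Gent energy\<close>

definition W_G :: "real \<Rightarrow> real \<Rightarrow> real^3^3 \<Rightarrow> real" where
  "W_G \<mu> J A = - (\<mu> / 2) * J * ln (1 - (trace A - 3) / J)"

definition w_s :: "real \<Rightarrow> real \<Rightarrow> (real^2) set \<Rightarrow> (real^2 \<Rightarrow> real^3) \<Rightarrow> real^2 \<Rightarrow> real" where
  "w_s \<mu> J S y x = - \<mu> * J * ln (1 - (trace (C0 S y x) - 2) / J)"

definition w_b :: "real \<Rightarrow> real \<Rightarrow> (real^2) set \<Rightarrow> (real^2 \<Rightarrow> real^3) \<Rightarrow> real^2 \<Rightarrow> real" where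
  "w_b \<mu> J S y x =
     \<mu> / 3 * J *
     (2 * ((tr_B_curv S y x - 2 * mean_curvature S y x) / (J - (trace (C0 S y x) - 2)))\<^sup>2
      + (16 * (mean_curvature S y x)\<^sup>2 - gauss_curvature S y x * (trace (C0 S y x) + 2))
        / (J - (trace (C0 S y x) - 2)))"

end

theory Submission
  imports Defs "HOL-Real_Asymp.Real_Asymp"
begin

text \<open>
  At a point of the closure write \<open>G = \<nabla>y\<close> and \<open>\<nabla>\<nu> = G M\<close>, where \<open>G\<^sup>T G M\<close> is symmetric because mixed
  partial derivatives of \<open>y\<close> commute; at boundary points both facts pass to the limit. Then
  \<open>2H = tr M\<close>, \<open>K = det M\<close>, \<open>T = tr (B \<nabla>\<^sub>s\<nu>) = tr (C M)\<close> and
  \<open>C\<^sub>\<phi> = (1 + \<phi>M)\<^sup>T C (1 + \<phi>M)\<close>. Hence \<open>det C\<^sub>f = 1\<close> forces \<open>(1 + 2H\<phi> + K\<phi>\<^sup>2) \<phi>' = 1\<close>, which integrates to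
  \<open>\<phi> + H\<phi>\<^sup>2 + K\<phi>\<^sup>3/3 = x\<^sub>3\<close>, while by Cayley-Hamilton
  \<open>I\<^sub>1 = tr C + 2T\<phi> + (2HT - K tr C) \<phi>\<^sup>2 + \<phi>'\<^sup>2\<close>. Expanding the energy to third order in \<open>x\<^sub>3\<close> and
  integrating over the symmetric interval gives the claim.
\<close>

section \<open>Commutation of mixed partial derivatives\<close>

text \<open>The second difference is \<open>?p h - ?p 0\<close>, where \<open>?p s\<close> is the
  increment of \<open>f\<close> under \<open>h *\<^sub>R v\<close> at
  \<open>x + s *\<^sub>R u\<close>. The mean value theorem in \<open>s\<close> turns it into an
  increment of \<open>fu\<close>, and a second application along \<open>v\<close> yields
  \<open>fuv\<close>. The radius bound keeps every point inside the ball.\<close>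

lemma second_difference_mvt:
  fixes f :: "'a::real_normed_vector \<Rightarrow> real"
  assumes h: "h > 0" "h * (norm u + norm v) < r"
    and fu: "\<And>z. z \<in> ball x r \<Longrightarrow> ((\<lambda>t. f (z + t *\<^sub>R u)) has_real_derivative fu z) (at 0)"
    and fuv: "\<And>z. z \<in> ball x r \<Longrightarrow> ((\<lambda>t. fu (z + t *\<^sub>R v)) has_real_derivative fuv z) (at 0)"
  shows "\<exists>z\<in>cball x (h * (norm u + norm v)).
    f (x + h *\<^sub>R u + h *\<^sub>R v) - f (x + h *\<^sub>R u) - f (x + h *\<^sub>R v) + f x = h\<^sup>2 * fuv z"
proof -
  have near: "x + s *\<^sub>R u + t *\<^sub>R v \<in> cball x (h * (norm u + norm v))"
    if "0 \<le> s" "s \<le> h" "0 \<le> t" "t \<le> h" for s t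
  proof -
    have "norm (s *\<^sub>R u + t *\<^sub>R v) \<le> s * norm u + t * norm v"
      using that norm_triangle_ineq[of "s *\<^sub>R u" "t *\<^sub>R v"] by simp
    also have "\<dots> \<le> h * norm u + h * norm v"
      using that by (intro add_mono mult_right_mono) auto
    finally show ?thesis by (simp add: dist_norm norm_minus_commute algebra_simps)
  qed
  \<comment> \<open>The directional derivatives are given at parameter 0 from every base point;
    shifting the base point gives them along the whole segment.\<close>
  have line: "((\<lambda>t. g (z + t *\<^sub>R w)) has_real_derivative d) (at s)"
    if "((\<lambda>t. g ((z + s *\<^sub>R w) + t *\<^sub>R w)) has_real_derivative d) (at 0)" for g :: "'a \<Rightarrow> real" and z w s d
    using that DERIV_shift[of "\<lambda>t. g (z + t *\<^sub>R w)" d 0 s]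
    by (simp add: algebra_simps scaleR_add_left add.assoc)
  have sub: "z \<in> ball x r" if "z \<in> cball x (h * (norm u + norm v))" for z
    using that h by auto
  let ?p = "\<lambda>s. f ((x + h *\<^sub>R v) + s *\<^sub>R u) - f (x + s *\<^sub>R u)"
  have "(?p has_real_derivative fu ((x + h *\<^sub>R v) + s *\<^sub>R u) - fu (x + s *\<^sub>R u)) (at s)"
    if "0 \<le> s" "s \<le> h" for s
    using that h near[of s h] near[of s 0]
    by (intro DERIV_diff line[OF fu] sub) (auto simp: algebra_simps)
  from MVT2[OF h(1), of ?p, OF this] obtain s where s: "0 < s" "s < h"
    and 1: "?p h - ?p 0 = h * (fu ((x + h *\<^sub>R v) + s *\<^sub>R u) - fu (x + s *\<^sub>R u))"
    by auto
  have "((\<lambda>t. fu ((x + s *\<^sub>R u) + t *\<^sub>R v)) has_real_derivative fuv ((x + s *\<^sub>R u) + t *\<^sub>R v)) (at t)"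
    if "0 \<le> t" "t \<le> h" for t
    using that s near[of s t] by (intro line[OF fuv] sub) auto
  from MVT2[OF h(1), of "\<lambda>t. fu ((x + s *\<^sub>R u) + t *\<^sub>R v)", OF this]
  obtain t where t: "0 < t" "t < h"
    and 2: "fu ((x + s *\<^sub>R u) + h *\<^sub>R v) - fu (x + s *\<^sub>R u) = h * fuv ((x + s *\<^sub>R u) + t *\<^sub>R v)"
    by auto
  show ?thesis
    using 1 2 near[of s t] s t
    by (intro bexI[of _ "x + s *\<^sub>R u + t *\<^sub>R v"]) (auto simp: algebra_simps power2_eq_square)
qed

text \<open>The second difference is symmetric in \<open>u\<close> and \<open>v\<close>, so it
  equals \<open>h\<^sup>2\<close> times a value of \<open>fuv\<close> and also
  \<open>h\<^sup>2\<close> times a value of \<open>fvu\<close>, both taken near \<open>x\<close>. By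
  continuity the two values at \<open>x\<close> cannot differ.\<close>

lemma mixed_partials_commute:
  fixes f :: "'a::real_normed_vector \<Rightarrow> real"
  assumes "open S" "x \<in> S"
    and fu: "\<And>z. z \<in> S \<Longrightarrow> ((\<lambda>t. f (z + t *\<^sub>R u)) has_real_derivative fu z) (at 0)"
    and fv: "\<And>z. z \<in> S \<Longrightarrow> ((\<lambda>t. f (z + t *\<^sub>R v)) has_real_derivative fv z) (at 0)"
    and fuv: "\<And>z. z \<in> S \<Longrightarrow> ((\<lambda>t. fu (z + t *\<^sub>R v)) has_real_derivative fuv z) (at 0)"
    and fvu: "\<And>z. z \<in> S \<Longrightarrow> ((\<lambda>t. fv (z + t *\<^sub>R u)) has_real_derivative fvu z) (at 0)"
    and cont: "isCont fuv x" "isCont fvu x"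
  shows "fuv x = fvu x"
proof (rule ccontr)
  assume neq: "fuv x \<noteq> fvu x"
  \<comment> \<open>Half the gap: numbers within \<open>e\<close> of \<open>fuv x\<close> and of
    \<open>fvu x\<close> respectively cannot coincide.\<close>
  define e where "e = dist (fuv x) (fvu x) / 2"
  have e: "e > 0" using neq by (simp add: e_def)
  obtain r where r: "r > 0" "ball x r \<subseteq> S" using assms openE by blast
  obtain d1 where d1: "d1 > 0" "\<And>z. dist z x < d1 \<Longrightarrow> dist (fuv z) (fuv x) < e"
    using cont(1) e unfolding continuous_at_eps_delta by blast
  obtain d2 where d2: "d2 > 0" "\<And>z. dist z x < d2 \<Longrightarrow> dist (fvu z) (fvu x) < e"
    using cont(2) e unfolding continuous_at_eps_delta by blast
  define d where "d = min d1 d2"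
  have d: "d > 0"
    "\<And>z. dist z x < d \<Longrightarrow> dist (fuv z) (fuv x) < e \<and> dist (fvu z) (fvu x) < e"
    using d1 d2 by (auto simp: d_def)
  \<comment> \<open>The summand 1 keeps the denominator positive when \<open>u\<close> and
    \<open>v\<close> both vanish and makes the bounds on \<open>h * (norm u + norm v)\<close>
    strict.\<close>
  define h where "h = min d r / (2 * (norm u + norm v + 1))"
  have h: "h > 0" using d r by (simp add: h_def add_nonneg_pos)
  have "h * (norm u + norm v) < h * (2 * (norm u + norm v + 1))"
    using h by (intro mult_strict_left_mono) (auto simp: add_nonneg_pos)
  also have "\<dots> = min d r"
  proof -
    have "0 < norm u + norm v + 1" by (simp add: add_nonneg_pos)
    then show ?thesis by (simp add: h_def less_imp_neq[THEN not_sym])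
  qed
  finally have lt: "h * (norm u + norm v) < d" "h * (norm u + norm v) < r" by auto
  obtain z where z: "z \<in> cball x (h * (norm u + norm v))"
    "f (x + h *\<^sub>R u + h *\<^sub>R v) - f (x + h *\<^sub>R u) - f (x + h *\<^sub>R v) + f x = h\<^sup>2 * fuv z"
    using second_difference_mvt[OF h lt(2), of x f fu fuv] fu fuv r(2) by blast
  have "h * (norm v + norm u) < r" using lt by (simp add: add.commute)
  from second_difference_mvt[OF h this, of x f fv fvu]
  obtain z' where "z' \<in> cball x (h * (norm v + norm u))"
    "f (x + h *\<^sub>R v + h *\<^sub>R u) - f (x + h *\<^sub>R v) - f (x + h *\<^sub>R u) + f x = h\<^sup>2 * fvu z'"
    using fv fvu r(2) by blast
  then have z': "z' \<in> cball x (h * (norm u + norm v))"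
    "f (x + h *\<^sub>R v + h *\<^sub>R u) - f (x + h *\<^sub>R v) - f (x + h *\<^sub>R u) + f x = h\<^sup>2 * fvu z'"
    by (simp_all add: add.commute)
  have "h\<^sup>2 * fuv z = h\<^sup>2 * fvu z'"
    using z(2) z'(2) by (simp add: algebra_simps)
  then have eq: "fuv z = fvu z'" using h by simp
  have "dist (fuv z) (fuv x) < e" "dist (fvu z') (fvu x) < e"
    using d(2)[of z] d(2)[of z'] z(1) z'(1) lt by (auto simp: dist_commute)
  then show False using eq unfolding e_def dist_real_def by (auto simp: abs_if split: if_splits)
qed

section \<open>Geometry of the surface\<close>

lemma Ck_closure_imp_continuous_on: "Ck_closure k S f \<Longrightarrow> continuous_on (closure S) f"
  by (cases k) auto

text \<open>Brings the recursive regularity notion into its working form: linearity assembles the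
  derivative on \<open>S\<close> from the partial derivatives \<open>g j\<close>, which extend to
  the closure with one order of regularity less.\<close>

lemma Ck_closure_Suc_partials:
  assumes "Ck_closure (Suc k) S f"
  shows "\<exists>g. (\<forall>j. Ck_closure k S (g j)) \<and>
    (\<forall>z\<in>S. (f has_derivative (\<lambda>v. \<Sum>j\<in>UNIV. v $ j *\<^sub>R g j z)) (at z))"
proof -
  obtain g where g: "\<And>j. Ck_closure k S (g j)"
    "\<And>j z. z \<in> S \<Longrightarrow> g j z = frechet_derivative f (at z) (axis j 1)"
    using assms by simp metis
  have "(f has_derivative (\<lambda>v. \<Sum>j\<in>UNIV. v $ j *\<^sub>R g j z)) (at z)" if "z \<in> S" for z
  proof -
    let ?D = "frechet_derivative f (at z)"
    have D: "(f has_derivative ?D) (at z)"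
      using assms that by (simp add: frechet_derivative_works)
    have lin: "linear ?D" using D has_derivative_linear by blast
    have "?D v = (\<Sum>j\<in>UNIV. v $ j *\<^sub>R g j z)" for v
    proof -
      have "v = (\<Sum>j\<in>UNIV. v $ j *\<^sub>R axis j 1)"
        by (simp add: vec_eq_iff axis_def if_distrib sum.delta' cong: if_cong)
      then have "?D v = ?D (\<Sum>j\<in>UNIV. v $ j *\<^sub>R axis j 1)" by simp
      then show ?thesis
        by (simp add: linear_sum[OF lin] linear_scale[OF lin] g(2)[OF that])
    qed
    then have "?D = (\<lambda>v. \<Sum>j\<in>UNIV. v $ j *\<^sub>R g j z)" by (rule ext)
    then show ?thesis using D by simp
  qed
  with g(1) show ?thesis by blast
qed

text \<open>On \<open>S\<close> the Jacobian has the columns \<open>g j\<close>. A closure point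
  outside \<open>S\<close> is a limit point of \<open>S\<close>, so the limit defining the gradient
  there is unique, and continuity of \<open>g j\<close> identifies it.\<close>

lemma column_grad:
  assumes "open S" and x: "x \<in> closure S"
    and der: "\<And>z. z \<in> S \<Longrightarrow> (f has_derivative (\<lambda>v. \<Sum>j\<in>UNIV. v $ j *\<^sub>R g j z)) (at z)"
    and cont: "\<And>j. continuous_on (closure S) (g j)"
  shows "column j (grad S f x) = g j x"
proof -
  have jac: "jacobian f (at z) = (\<chi> i j. g j z $ i)" if "z \<in> S" for z
    unfolding jacobian_def frechet_derivative_at[OF der[OF that], symmetric]
    by (simp add: matrix_def vec_eq_iff axis_def if_distrib if_distribR sum.delta' cong: if_cong)
  have "grad S f x = (\<chi> i j. g j x $ i)"
  proof (cases "x \<in> S")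
    case False
    then have nt: "at x within S \<noteq> bot"
      using x by (simp add: closure_def trivial_limit_within)
    have "((\<lambda>z. \<chi> i j. g j z $ i) \<longlongrightarrow> (\<chi> i j. g j x $ i)) (at x within S)"
    proof (intro tendsto_vec_lambda tendsto_vec_nth)
      fix i j
      have "(g j \<longlongrightarrow> g j x) (at x within closure S)"
        using cont x by (simp add: continuous_on_def)
      then show "(g j \<longlongrightarrow> g j x) (at x within S)"
        by (rule tendsto_within_subset) (rule closure_subset)
    qed
    then have "((\<lambda>z. jacobian f (at z)) \<longlongrightarrow> (\<chi> i j. g j x $ i)) (at x within S)"
      by (rule Lim_transform_eventually) (auto simp: eventually_at_filter jac)
    then show ?thesis using False nt by (simp add: grad_def tendsto_Lim)
  qed (simp add: grad_def jac)
  then show ?thesis by (simp add: column_def vec_eq_iff)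
qed

text \<open>On \<open>S\<close> the symmetry holds in each component by
  \<open>mixed_partials_commute\<close>. The difference of the two sides is continuous on the
  closure and vanishes on \<open>S\<close>, hence vanishes at boundary points as well.\<close>

lemma second_partials_commute:
  fixes f :: "real^2 \<Rightarrow> real^3"
  assumes S: "open S" and x: "x \<in> closure S"
    and f: "\<And>z. z \<in> S \<Longrightarrow> (f has_derivative (\<lambda>v. \<Sum>j\<in>UNIV. v $ j *\<^sub>R g j z)) (at z)"
    and g: "\<And>i z. z \<in> S \<Longrightarrow> (g i has_derivative (\<lambda>v. \<Sum>j\<in>UNIV. v $ j *\<^sub>R gg i j z)) (at z)"
    and cont: "\<And>i j. continuous_on (closure S) (gg i j)"
  shows "gg i j x = gg j i x"
proof -
  have partial: "((\<lambda>t. F (z + t *\<^sub>R axis j 1) $ k) has_real_derivative dF j z $ k) (at 0)"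
    if "(F has_derivative (\<lambda>v. \<Sum>j\<in>UNIV. v $ j *\<^sub>R dF j z)) (at z)"
    for F :: "real^2 \<Rightarrow> real^3" and dF z j k
  proof -
    have "((\<lambda>t. F (z + t *\<^sub>R axis j 1) $ k) has_derivative
        (\<lambda>t. (\<Sum>i\<in>UNIV. (t *\<^sub>R axis j 1) $ i *\<^sub>R dF i z) $ k)) (at 0)"
      by (rule bounded_linear.has_derivative[OF bounded_linear_vec_nth], rule has_derivative_compose[of "\<lambda>t. z + t *\<^sub>R axis j 1"])
        (auto intro!: derivative_eq_intros simp: that)
    moreover have "(\<lambda>t. (\<Sum>i\<in>UNIV. (t *\<^sub>R axis j 1) $ i *\<^sub>R dF i z) $ k) = (*) (dF j z $ k)"
      by (auto simp: fun_eq_iff axis_def if_distrib if_distribR sum.delta' cong: if_cong)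
    ultimately show ?thesis by (simp add: has_field_derivative_def)
  qed
  have S_eq: "gg i j z = gg j i z" if z: "z \<in> S" for z
  proof -
    have "gg i j z $ k = gg j i z $ k" for k
    proof (rule mixed_partials_commute[OF S z, where f = "\<lambda>z. f z $ k" and u = "axis i 1"
          and v = "axis j 1" and fu = "\<lambda>z. g i z $ k" and fv = "\<lambda>z. g j z $ k"])
      have "isCont (gg i j) z" for i j
        using continuous_on_subset[OF cont closure_subset] S z
        by (simp add: continuous_on_eq_continuous_at)
      then show "isCont (\<lambda>z. gg i j z $ k) z" "isCont (\<lambda>z. gg j i z $ k) z"
        by (auto intro: continuous_intros)
    qed (rule partial[OF f] partial[OF g]; assumption)+
    then show ?thesis by (simp add: vec_eq_iff)
  qed
  show ?thesis
    using continuous_constant_on_closure[of S "\<lambda>z. gg i j z - gg j i z" 0 x] cont S_eq x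
    by (auto intro!: continuous_intros)
qed

text \<open>The derivative of the norm is the component of \<open>f' v\<close> along
  \<open>u\<close>, so the quotient rule leaves the part of \<open>f' v\<close> orthogonal to
  \<open>u\<close>, divided by the norm. Orthogonality to \<open>u\<close> can be read off this
  form.\<close>

lemma has_derivative_normalize:
  fixes f :: "'a::real_normed_vector \<Rightarrow> 'b::real_inner"
  assumes f: "(f has_derivative f') (at x)" and nz: "f x \<noteq> 0"
  defines "u \<equiv> (1 / norm (f x)) *\<^sub>R f x"
  shows "((\<lambda>z. (1 / norm (f z)) *\<^sub>R f z) has_derivative
    (\<lambda>v. (1 / norm (f x)) *\<^sub>R (f' v - (f' v \<bullet> u) *\<^sub>R u))) (at x)"
proof -
  have nrm: "((\<lambda>z. norm (f z)) has_derivative (\<lambda>v. f' v \<bullet> u)) (at x)"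
    using has_derivative_compose[OF f has_derivative_norm[OF nz]]
    by (simp add: u_def sgn_div_norm inner_commute divide_inverse)
  have "((\<lambda>z. (1 / norm (f z)) *\<^sub>R f z) has_derivative
    (\<lambda>v. (1 / norm (f x)) *\<^sub>R f' v + (- (f' v \<bullet> u) / (norm (f x))\<^sup>2) *\<^sub>R f x)) (at x)"
    using nz by (auto intro!: derivative_eq_intros nrm f simp: power2_eq_square)
  then show ?thesis
    by (simp add: u_def algebra_simps power2_eq_square divide_inverse)
qed

text \<open>Cramer's rule for the coordinates of \<open>w\<close> with respect to \<open>a\<close>,
  \<open>b\<close>, \<open>n\<close>. Multiplying through by \<open>n \<bullet> n\<close> makes it a
  polynomial identity, valid also for dependent \<open>a\<close> and \<open>b\<close>.\<close>

lemma cross_expansion: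
  fixes a b w :: "real^3"
  defines "n \<equiv> cross3 a b"
  shows "(n \<bullet> n) *\<^sub>R w = (cross3 w b \<bullet> n) *\<^sub>R a + (cross3 a w \<bullet> n) *\<^sub>R b + (w \<bullet> n) *\<^sub>R n"
  unfolding n_def
  by (simp add: cross3_def vec_eq_iff forall_3 inner_vec_def sum_3 vector_3) algebra

lemma matrix_vector_mult_columns_2:
  "(A :: real^2^'m) *v r = r $ 1 *\<^sub>R column 1 A + r $ 2 *\<^sub>R column 2 A"
  by (simp add: vec_eq_iff matrix_vector_mult_def sum_2 column_def mult.commute)

lemma column_matrix_mult: "column j (A ** B) = A *v column j (B :: real^'k^'n)"
  by (simp add: vec_eq_iff column_def matrix_vector_mult_def matrix_matrix_mult_def)

lemma matrix_eq_columns: "A = B \<longleftrightarrow> (\<forall>j. column j A = column j B)"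
  by (auto simp: vec_eq_iff column_def)

text \<open>If the product of the columns \<open>?a\<close> and \<open>?b\<close> vanished, the
  triple product identity for \<open>cross3 ?b (cross3 ?a ?b)\<close> would put the vector with
  entries \<open>?b \<bullet> ?b\<close> and \<open>- (?a \<bullet> ?b)\<close> in the kernel.
  Injectivity then forces \<open>?b\<close> to be zero, which puts \<open>axis 2 1\<close> in the
  kernel.\<close>

lemma cross_columns_nonzero:
  fixes A :: "real^2^3"
  assumes "inj (\<lambda>v. A *v v)"
  shows "cross3 (column 1 A) (column 2 A) \<noteq> 0"
proof
  assume n: "cross3 (column 1 A) (column 2 A) = 0"
  let ?a = "column 1 A" and ?b = "column 2 A"
  have ker: "v = 0" if "A *v v = 0" for v
    using injD[OF assms, of v 0] that by simp
  have "A *v (\<chi> i. if i = 1 then ?b \<bullet> ?b else - (?a \<bullet> ?b)) = 0"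
  proof -
    have "(?b \<bullet> ?b) *\<^sub>R ?a - (?a \<bullet> ?b) *\<^sub>R ?b = cross3 ?b (cross3 ?a ?b)"
      by (simp add: cross3_simps forall_3)
    then show ?thesis using n by (simp add: matrix_vector_mult_columns_2)
  qed
  from ker[OF this] have "?b \<bullet> ?b = 0" by (simp add: vec_eq_iff forall_2)
  then have "A *v axis 2 1 = 0"
    by (simp add: matrix_vector_mult_columns_2 axis_def)
  from ker[OF this] show False by simp
qed

lemma range_columns_eq_orthogonal:
  fixes A :: "real^2^3"
  assumes "inj (\<lambda>v. A *v v)"
  shows "range (\<lambda>v. A *v v) = {w. w \<bullet> cross3 (column 1 A) (column 2 A) = 0}"
proof (intro equalityI subsetI)
  fix w assume "w \<in> range (\<lambda>v. A *v v)"
  then show "w \<in> {w. w \<bullet> cross3 (column 1 A) (column 2 A) = 0}"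
    by (auto simp: matrix_vector_mult_columns_2 inner_left_distrib dot_cross_self)
next
  fix w assume w: "w \<in> {w. w \<bullet> cross3 (column 1 A) (column 2 A) = 0}"
  let ?a = "column 1 A" and ?b = "column 2 A"
  let ?n = "cross3 ?a ?b"
  \<comment> \<open>The coefficients are those of \<open>cross_expansion\<close>; its third term
    drops out because \<open>w\<close> is orthogonal to \<open>?n\<close>.\<close>
  have "w = A *v ((1 / (?n \<bullet> ?n)) *\<^sub>R (\<chi> i. if i = 1 then cross3 w ?b \<bullet> ?n else cross3 ?a w \<bullet> ?n))"
  proof -
    have "w = (1 / (?n \<bullet> ?n)) *\<^sub>R ((?n \<bullet> ?n) *\<^sub>R w)"
      using cross_columns_nonzero[OF assms] by simp
    also have "(?n \<bullet> ?n) *\<^sub>R w = (cross3 w ?b \<bullet> ?n) *\<^sub>R ?a + (cross3 ?a w \<bullet> ?n) *\<^sub>R ?b"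
      using w by (simp add: cross_expansion)
    finally show ?thesis by (simp add: matrix_vector_mult_columns_2 scaleR_add_right)
  qed
  then show "w \<in> range (\<lambda>v. A *v v)" by blast
qed

section \<open>The unit normal and its gradient\<close>

lemma unit_normal_eq:
  "unit_normal S y x = (1 / norm (cross3 (column 1 (grad S y x)) (column 2 (grad S y x)))) *\<^sub>R
     cross3 (column 1 (grad S y x)) (column 2 (grad S y x))"
  by (simp add: unit_normal_def Let_def)

lemma bounded_bilinear_cross3: "bounded_bilinear cross3"
  using bilinear_cross bilinear_conv_bounded_bilinear by blast

text \<open>Normalisation leaves only the tangential part of the derivative of the normal, whence
  the first claim. Only this part of \<open>dn\<close> matters for products with \<open>g i\<close>,
  and equality of mixed second derivatives of \<open>y\<close> gives the symmetry.\<close>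

lemma unit_normal_gradient:
  assumes S: "open S" and y: "C3_immersion_closure S y" and x: "x \<in> closure S"
  shows "column j (grad S (unit_normal S y) x) \<bullet> unit_normal S y x = 0"
    and "transpose (grad S y x) ** grad S (unit_normal S y) x =
         transpose (grad S (unit_normal S y) x) ** grad S y x"
proof -
  have inj: "inj (\<lambda>v. grad S y z *v v)" if "z \<in> closure S" for z
    using y that by (simp add: C3_immersion_closure_def)
  have "Ck_closure (Suc (Suc (Suc 0))) S y"
    using y by (simp only: C3_immersion_closure_def numeral_3_eq_3)
  from Ck_closure_Suc_partials[OF this]
  obtain g where g: "\<And>j. Ck_closure (Suc (Suc 0)) S (g j)"
    "\<And>z. z \<in> S \<Longrightarrow> (y has_derivative (\<lambda>v. \<Sum>j\<in>UNIV. v $ j *\<^sub>R g j z)) (at z)"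
    by blast
  have "\<exists>gg. (\<forall>j. Ck_closure (Suc 0) S (gg j)) \<and>
    (\<forall>z\<in>S. (g i has_derivative (\<lambda>v. \<Sum>j\<in>UNIV. v $ j *\<^sub>R gg j z)) (at z))" for i
    by (rule Ck_closure_Suc_partials[OF g(1)])
  then have "\<forall>i. \<exists>gg. (\<forall>j. Ck_closure (Suc 0) S (gg j)) \<and>
    (\<forall>z\<in>S. (g i has_derivative (\<lambda>v. \<Sum>j\<in>UNIV. v $ j *\<^sub>R gg j z)) (at z))" ..
  from choice[OF this] obtain gg where gg: "\<And>i j. Ck_closure (Suc 0) S (gg i j)"
    "\<And>i z. z \<in> S \<Longrightarrow> (g i has_derivative (\<lambda>v. \<Sum>j\<in>UNIV. v $ j *\<^sub>R gg i j z)) (at z)"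
    by blast
  have cont: "continuous_on (closure S) (g i)" "continuous_on (closure S) (gg i j)" for i j
    using g(1) gg(1) Ck_closure_imp_continuous_on by blast+
  have col: "column j (grad S y z) = g j z" if "z \<in> closure S" for j z
    using column_grad[OF S that g(2) cont(1)] .
  have comm: "gg i j x = gg j i x" for i j
    using second_partials_commute[OF S x g(2) gg(2) cont(2)] .
  \<comment> \<open>Written with the extensions \<open>g\<close> and \<open>gg\<close>, these
    functions are continuous on the closure. Thus \<open>du\<close> supplies the partial derivatives
    of the normal at boundary points too.\<close>
  define n where "n = (\<lambda>z. cross3 (g 1 z) (g 2 z))"
  define dn where "dn = (\<lambda>j z. cross3 (g 1 z) (gg 2 j z) + cross3 (gg 1 j z) (g 2 z))"
  define u where "u = (\<lambda>z. (1 / norm (n z)) *\<^sub>R n z)"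
  define du where "du = (\<lambda>j z. (1 / norm (n z)) *\<^sub>R (dn j z - (dn j z \<bullet> u z) *\<^sub>R u z))"
  have nz: "n z \<noteq> 0" if "z \<in> closure S" for z
    using cross_columns_nonzero[OF inj[OF that]] col[OF that] by (simp add: n_def)
  have u_eq: "unit_normal S y z = u z" if "z \<in> closure S" for z
    by (simp add: unit_normal_eq u_def n_def col[OF that])
  have contn: "continuous_on (closure S) n" unfolding n_def
    by (intro continuous_on_cross cont)
  have contu: "continuous_on (closure S) u" unfolding u_def
    by (intro continuous_intros contn) (auto simp: nz)
  have contdu: "continuous_on (closure S) (du j)" for j unfolding du_def dn_def
    by (intro continuous_intros continuous_on_cross contn contu cont) (auto simp: nz)
  have der: "(unit_normal S y has_derivative (\<lambda>v. \<Sum>j\<in>UNIV. v $ j *\<^sub>R du j z)) (at z)"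
    if z: "z \<in> S" for z
  proof -
    have zc: "z \<in> closure S" using z closure_subset by blast
    have "(n has_derivative (\<lambda>v. cross3 (g 1 z) (\<Sum>j\<in>UNIV. v $ j *\<^sub>R gg 2 j z)
        + cross3 (\<Sum>j\<in>UNIV. v $ j *\<^sub>R gg 1 j z) (g 2 z))) (at z)"
      unfolding n_def by (intro bounded_bilinear.FDERIV[OF bounded_bilinear_cross3] gg(2) z)
    then have "(n has_derivative (\<lambda>v. \<Sum>j\<in>UNIV. v $ j *\<^sub>R dn j z)) (at z)"
      by (simp only: sum_2 dn_def cross_add_left cross_add_right cross_mult_left
          cross_mult_right scaleR_add_right ac_simps)
    from has_derivative_normalize[OF this nz[OF zc]]
    have "(u has_derivative (\<lambda>v. (1 / norm (n z)) *\<^sub>R ((\<Sum>j\<in>UNIV. v $ j *\<^sub>R dn j z)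
        - ((\<Sum>j\<in>UNIV. v $ j *\<^sub>R dn j z) \<bullet> u z) *\<^sub>R u z))) (at z)"
      unfolding u_def .
    also have "(\<lambda>v. (1 / norm (n z)) *\<^sub>R ((\<Sum>j\<in>UNIV. v $ j *\<^sub>R dn j z)
        - ((\<Sum>j\<in>UNIV. v $ j *\<^sub>R dn j z) \<bullet> u z) *\<^sub>R u z)) = (\<lambda>v. \<Sum>j\<in>UNIV. v $ j *\<^sub>R du j z)"
      by (simp add: fun_eq_iff sum_2 du_def inner_add_left scaleR_add_right scaleR_add_left
          scaleR_diff_right)
    finally have "(u has_derivative (\<lambda>v. \<Sum>j\<in>UNIV. v $ j *\<^sub>R du j z)) (at z)" .
    then show ?thesis
      by (rule has_derivative_transform_within_open[OF _ S z])
        (simp add: u_eq subsetD[OF closure_subset])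
  qed
  have coln: "column j (grad S (unit_normal S y) x) = du j x" for j
    using column_grad[OF S x der contdu] .
  have uu: "u x \<bullet> u x = 1" using nz[OF x] by (simp add: u_def power2_norm_eq_inner[symmetric] power2_eq_square)
  show "column j (grad S (unit_normal S y) x) \<bullet> unit_normal S y x = 0"
    by (simp add: coln u_eq[OF x] du_def inner_diff_left uu)
  have dot_u: "u x \<bullet> g i x = 0" for i
    using exhaust_2[of i] by (auto simp: u_def n_def dot_cross_self)
  have "du 1 x \<bullet> g 2 x = du 2 x \<bullet> g 1 x"
  proof -
    \<comment> \<open>In each product one summand vanishes by repetition of a factor. The remaining
      triple products agree by cyclic symmetry once \<open>gg 2 1 x\<close> is replaced by
      \<open>gg 1 2 x\<close>.\<close>
    have "dn 1 x \<bullet> g 2 x = dn 2 x \<bullet> g 1 x"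
      unfolding dn_def comm[of 2 1] by (simp add: cross3_simps)
    then show ?thesis by (simp add: du_def inner_diff_left dot_u)
  qed
  then have "du j x \<bullet> g i x = du i x \<bullet> g j x" for i j
    using exhaust_2[of i] exhaust_2[of j] by auto
  moreover have "(transpose A ** B) $ i $ j = column i A \<bullet> column j B" for A B :: "real^2^3" and i j
    by (simp add: matrix_matrix_mult_def transpose_def column_def inner_vec_def)
  ultimately show "transpose (grad S y x) ** grad S (unit_normal S y) x =
         transpose (grad S (unit_normal S y) x) ** grad S y x"
    by (simp add: vec_eq_iff coln col[OF x] inner_commute)
qed

text \<open>The columns of the gradient of the normal are orthogonal to the normal, hence lie in the
  range of the gradient of \<open>y\<close>. \<open>M\<close> is the matrix of the curvature tensor
  in the basis formed by the columns of \<open>grad S y x\<close>.\<close>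

lemma grad_unit_normal_factor:
  assumes S: "open S" and y: "C3_immersion_closure S y" and x: "x \<in> closure S"
  shows "\<exists>M. grad S (unit_normal S y) x = grad S y x ** M"
proof -
  let ?G = "grad S y x" and ?N = "grad S (unit_normal S y) x"
  have inj: "inj (\<lambda>v. ?G *v v)" using y x by (simp add: C3_immersion_closure_def)
  have "column j ?N \<in> range (\<lambda>v. ?G *v v)" for j
    using unit_normal_gradient(1)[OF assms, of j] cross_columns_nonzero[OF inj]
    by (simp add: range_columns_eq_orthogonal[OF inj] unit_normal_eq)
  then have "\<forall>j. \<exists>r. column j ?N = ?G *v r" by blast
  from choice[OF this] obtain m where "\<And>j. column j ?N = ?G *v m j" by blast
  then have "?N = ?G ** (\<chi> i j. m j $ i)"
    by (simp add: matrix_eq_columns column_matrix_mult) (simp add: column_def)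
  then show ?thesis ..
qed

section \<open>Trace and determinant on the tangent plane\<close>

lemma tangent_plane_eq_range:
  assumes "inj (\<lambda>v. grad S y x *v v)"
  shows "tangent_plane S y x = range (\<lambda>v. grad S y x *v v)"
  using cross_columns_nonzero[OF assms] unfolding range_columns_eq_orthogonal[OF assms]
  by (auto simp: tangent_plane_def orthogonal_comp_def orthogonal_def unit_normal_eq inner_commute)

text \<open>The basis selected in \<^const>\<open>plane_matrix\<close> differs from the columns of \<open>A\<close> by an invertible
  change of basis \<open>R\<close>, which conjugates the matrix of the endomorphism.\<close>

lemma plane_matrix_range:
  fixes A :: "real^2^3"
  assumes inj: "inj (\<lambda>v. A *v v)" and L: "\<And>v. L (A *v v) = A *v (M *v v)"
  obtains R Q :: "real^2^2" where "Q ** R = mat 1" "R ** Q = mat 1"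
    "plane_matrix (range (\<lambda>v. A *v v)) L = Q ** M ** R"
proof -
  let ?V = "range (\<lambda>v. A *v v)"
  let ?P = "\<lambda>U :: real^2^3. transpose U ** U = mat 1 \<and> span {column 1 U, column 2 U} = ?V"
  define n where "n = cross3 (column 1 A) (column 2 A)"
  have span2: "span {column 1 U, column 2 U} = range (\<lambda>v. U *v v)" for U :: "real^2^3"
  proof -
    have "range (\<lambda>v. U *v v) = {c *\<^sub>R column 1 U + d *\<^sub>R column 2 U | c d. True}"
    proof (intro equalityI subsetI)
      fix w assume "w \<in> {c *\<^sub>R column 1 U + d *\<^sub>R column 2 U | c d. True}"
      then obtain c d where "w = c *\<^sub>R column 1 U + d *\<^sub>R column 2 U" by blast
      then have "w = U *v (\<chi> i. if i = 1 then c else d)"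
        by (simp add: matrix_vector_mult_columns_2)
      then show "w \<in> range (\<lambda>v. U *v v)" by blast
    qed (auto simp: matrix_vector_mult_columns_2)
    then show ?thesis by (auto simp: span_insert span_singleton algebra_simps)
  qed
  have "\<exists>U. ?P U"
  proof -
    \<comment> \<open>An orthonormal basis must be exhibited for \<open>SOME\<close> to denote one:
      the normalised first column of \<open>A\<close>, and a unit vector orthogonal to it and to
      \<open>n\<close>.\<close>
    define e where "e = (1 / norm (column 1 A)) *\<^sub>R column 1 A"
    define f where "f = (1 / norm n) *\<^sub>R cross3 n e"
    define U :: "real^2^3" where "U = (\<chi> i j. if j = 1 then e $ i else f $ i)"
    have colU: "column 1 U = e" "column 2 U = f" by (auto simp: U_def column_def vec_eq_iff)
    have n: "n \<noteq> 0" using cross_columns_nonzero[OF inj] by (simp add: n_def)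
    have ee: "e \<bullet> e = 1"
      using n by (cases "column 1 A = 0") (auto simp: e_def n_def power2_norm_eq_inner[symmetric] power2_eq_square)
    have ne: "n \<bullet> e = 0" by (simp add: n_def e_def dot_cross_self)
    have ef: "e \<bullet> f = 0" by (simp add: f_def dot_cross_self)
    have "(norm (cross3 n e))\<^sup>2 = (norm n)\<^sup>2"
      using norm_cross_dot[of n e] ee ne by (simp add: power_mult_distrib power2_norm_eq_inner)
    then have ff: "f \<bullet> f = 1"
      using n by (simp add: f_def power2_norm_eq_inner[symmetric] power_divide)
    have UU: "transpose U ** U = mat 1"
      using ee ef ff
      by (simp add: vec_eq_iff forall_2 matrix_matrix_mult_def transpose_def U_def mat_def
          inner_vec_def mult.commute)
    then have injU: "inj (\<lambda>v. U *v v)"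
      by (intro injI) (metis matrix_vector_mul_assoc matrix_vector_mul_lid)
    \<comment> \<open>The columns of \<open>U\<close> have a cross product parallel to
      \<open>n\<close>, so \<open>U\<close> and \<open>A\<close> have the same orthogonal complement
      of a normal as range.\<close>
    have "cross3 e (cross3 n e) = (e \<bullet> e) *\<^sub>R n - (n \<bullet> e) *\<^sub>R e"
      by (simp add: cross3_simps forall_3)
    then have "cross3 e f = (1 / norm n) *\<^sub>R n" by (simp add: f_def cross_mult_right ee ne)
    then have "range (\<lambda>v. U *v v) = ?V"
      using n unfolding range_columns_eq_orthogonal[OF inj] range_columns_eq_orthogonal[OF injU]
      by (auto simp: colU n_def)
    then show ?thesis using UU span2 by blast
  qed
  define U where "U = (SOME U. ?P U)"
  have U: "transpose U ** U = mat 1" "range (\<lambda>v. U *v v) = ?V"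
    using someI_ex[OF \<open>\<exists>U. ?P U\<close>] span2 unfolding U_def by auto
  have "\<exists>r. column j U = A *v r" for j
  proof -
    have "column j U \<in> range (\<lambda>v. U *v v)"
      by (metis matrix_vector_mult_basis rangeI)
    then show ?thesis using U(2) by auto
  qed
  then have "\<forall>j. \<exists>r. column j U = A *v r" ..
  from choice[OF this] obtain r where "\<And>j. column j U = A *v r j" by blast
  then have UR: "U = A ** (\<chi> i j. r j $ i)" (is "U = A ** ?R")
    by (simp add: matrix_eq_columns column_matrix_mult) (simp add: column_def)
  have QR: "transpose U ** A ** ?R = mat 1"
    using U(1) UR by (metis matrix_mul_assoc)
  have "plane_matrix ?V L = transpose U ** (A ** (M ** ?R))"
  proof -
    have "L (column j U) = column j (A ** (M ** ?R))" for j
      by (subst UR) (simp add: column_matrix_mult L)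
    then show ?thesis
      unfolding plane_matrix_def Let_def U_def[symmetric]
      by (simp add: vec_eq_iff matrix_matrix_mult_def transpose_def column_def inner_vec_def)
  qed
  then have "plane_matrix ?V L = transpose U ** A ** M ** ?R" by (simp only: matrix_mul_assoc)
  \<comment> \<open>Here \<open>transpose U ** A\<close> serves as \<open>Q\<close>; for square
    matrices a left inverse is also a right inverse.\<close>
  with QR QR[unfolded matrix_left_right_inverse[of "transpose U ** A"]] show ?thesis by (rule that)
qed

text \<open>Cyclicity of the trace removes the conjugation, so curvature traces can be computed from
  the coordinate matrix \<open>M\<close>.\<close>

lemma plane_trace_range:
  fixes A :: "real^2^3"
  assumes "inj (\<lambda>v. A *v v)" and "\<And>v. L (A *v v) = A *v (M *v v)"
  shows "plane_trace (range (\<lambda>v. A *v v)) L = trace M"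
proof -
  obtain R Q :: "real^2^2" where "Q ** R = mat 1" "R ** Q = mat 1"
    "plane_matrix (range (\<lambda>v. A *v v)) L = Q ** M ** R"
    using plane_matrix_range[OF assms] .
  then show ?thesis
    by (metis plane_trace_def trace_mul_sym matrix_mul_assoc matrix_mul_lid)
qed

lemma plane_det_range:
  fixes A :: "real^2^3"
  assumes "inj (\<lambda>v. A *v v)" and "\<And>v. L (A *v v) = A *v (M *v v)"
  shows "plane_det (range (\<lambda>v. A *v v)) L = det M"
proof -
  obtain R Q :: "real^2^2" where QR: "Q ** R = mat 1" "R ** Q = mat 1"
    "plane_matrix (range (\<lambda>v. A *v v)) L = Q ** M ** R"
    using plane_matrix_range[OF assms] .
  have "det Q * det R = 1" using QR(1) by (metis det_mul det_I)
  then show ?thesis by (simp add: plane_det_def QR(3) det_mul mult.commute mult.left_commute)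
qed

text \<open>The Cayley-Hamilton identity for \<open>M\<close>, multiplied by \<open>A\<close> on the
  left, under the trace.\<close>

lemma trace_mult_square_2:
  fixes A M :: "real^2^2"
  shows "trace (A ** M ** M) = trace M * trace (A ** M) - det M * trace A"
  by (simp add: trace_def matrix_matrix_mult_def sum_2 det_2 algebra_simps)

lemma det_id_plus_scaleR_2:
  fixes M :: "real^2^2"
  shows "det (mat 1 + p *\<^sub>R M) = 1 + trace M * p + det M * p\<^sup>2"
  by (simp add: det_2 trace_def sum_2 mat_def algebra_simps power2_eq_square)

text \<open>The tensor is block diagonal with blocks \<open>A\<close> and \<open>d\<close>.\<close>

lemma det_incl_plus_tensor:
  "det (incl ** A ** transpose incl + d *\<^sub>R tensor_prod e3 e3) = det A * d"
  by (simp add: det_2 det_3 incl_def matrix_matrix_mult_def transpose_def sum_2 tensor_prod_def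
      e3_def axis_def vector_2 vector_3 algebra_simps)

lemma trace_incl_plus_tensor:
  "trace (incl ** A ** transpose incl + d *\<^sub>R tensor_prod e3 e3) = trace A + d"
  by (simp add: trace_def incl_def matrix_matrix_mult_def transpose_def sum_2 sum_3 tensor_prod_def
      e3_def axis_def vector_2 vector_3 algebra_simps)

lemma strain_invariants:
  assumes S: "open S" and y: "C3_immersion_closure S y" and x: "x \<in> closure S"
  defines "H \<equiv> mean_curvature S y x" and "K \<equiv> gauss_curvature S y x"
    and "T \<equiv> tr_B_curv S y x" and "a \<equiv> trace (C0 S y x)"
  shows "det (C_f S y h \<phi> x t) =
      det (C0 S y x) * (1 + 2 * H * \<phi> x t + K * (\<phi> x t)\<^sup>2)\<^sup>2 * (deriv3 h \<phi> x t)\<^sup>2"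
    and "trace (C_f S y h \<phi> x t) =
      a + 2 * T * \<phi> x t + (2 * H * T - K * a) * (\<phi> x t)\<^sup>2 + (deriv3 h \<phi> x t)\<^sup>2"
proof -
  let ?G = "grad S y x" and ?N = "grad S (unit_normal S y) x" and ?C = "C0 S y x"
  let ?p = "\<phi> x t"
  have inj: "inj (\<lambda>v. ?G *v v)" using y x by (simp add: C3_immersion_closure_def)
  obtain M where M: "?N = ?G ** M" using grad_unit_normal_factor[OF S y x] by blast
  have curv: "curvature_tensor S y x (?G *v v) = ?G *v (M *v v)" for v
    using inv_f_f[OF inj, of v] by (simp add: curvature_tensor_def M matrix_vector_mul_assoc)
  \<comment> \<open>Reassociating the product of \<open>?G\<close>, its transpose, \<open>?G\<close>
    and \<open>M\<close> lets \<open>?C\<close> appear in the middle, so \<open>?C ** M\<close>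
    represents the composite tensor in the columns of \<open>?G\<close>.\<close>
  have BL: "(B_tensor S y x \<circ> curvature_tensor S y x) (?G *v v) = ?G *v ((?C ** M) *v v)" for v
    by (simp add: curv B_tensor_def C0_def matrix_vector_mul_assoc matrix_mul_assoc)
  have HKT: "2 * H = trace M" "K = det M" "T = trace (?C ** M)"
    unfolding H_def K_def T_def mean_curvature_def gauss_curvature_def tr_B_curv_def
      tangent_plane_eq_range[OF inj]
    by (simp_all add: plane_trace_range[OF inj curv] plane_det_range[OF inj curv]
        plane_trace_range[OF inj BL])
  \<comment> \<open>This is the symmetry of the second fundamental form; it allows all factors
    \<open>M\<close> to be collected to the right of \<open>?C\<close>.\<close>
  have sym: "transpose M ** ?C = ?C ** M"
    using unit_normal_gradient(2)[OF S y x]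
    by (simp add: M C0_def matrix_transpose_mul matrix_mul_assoc)
  have C1: "C1 S y x = ?C ** M + ?C ** M"
    using sym by (simp add: C1_def M C0_def matrix_transpose_mul matrix_mul_assoc)
  have C2: "C2 S y x = ?C ** M ** M"
    using sym by (simp add: C2_def M C0_def matrix_transpose_mul matrix_mul_assoc)
  have "C_phi S y \<phi> x t = transpose (mat 1 + ?p *\<^sub>R M) ** ?C ** (mat 1 + ?p *\<^sub>R M)"
  proof -
    have "transpose (mat 1 + ?p *\<^sub>R M) ** ?C = ?C + ?p *\<^sub>R (?C ** M)"
      unfolding sym[symmetric]
      by (simp add: vec_eq_iff transpose_def matrix_matrix_mult_def sum_2 mat_def forall_2 algebra_simps)
    moreover have "(?C + ?p *\<^sub>R (?C ** M)) ** (mat 1 + ?p *\<^sub>R M)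
        = ?C + ?p *\<^sub>R (?C ** M + ?C ** M) + ?p\<^sup>2 *\<^sub>R (?C ** M ** M)"
      by (simp add: vec_eq_iff matrix_matrix_mult_def sum_2 mat_def forall_2 algebra_simps power2_eq_square)
    ultimately show ?thesis by (simp add: C_phi_def C1 C2)
  qed
  then have "det (C_phi S y \<phi> x t) = det ?C * (1 + 2 * H * ?p + K * ?p\<^sup>2)\<^sup>2"
    by (simp add: det_mul det_transpose det_id_plus_scaleR_2 HKT power2_eq_square)
  then show "det (C_f S y h \<phi> x t) =
      det (C0 S y x) * (1 + 2 * H * \<phi> x t + K * (\<phi> x t)\<^sup>2)\<^sup>2 * (deriv3 h \<phi> x t)\<^sup>2"
    by (simp add: C_f_def det_incl_plus_tensor)
  have lin: "trace (A + p *\<^sub>R B + q *\<^sub>R C) = trace A + p * trace B + q * trace C"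
    for A B C :: "real^2^2" and p q
    by (simp add: trace_def sum_2 algebra_simps)
  show "trace (C_f S y h \<phi> x t) =
      a + 2 * T * \<phi> x t + (2 * H * T - K * a) * (\<phi> x t)\<^sup>2 + (deriv3 h \<phi> x t)\<^sup>2"
    unfolding C_f_def trace_incl_plus_tensor
    unfolding C_phi_def lin
    unfolding C1 C2 trace_add trace_mult_square_2 HKT a_def
    by (simp add: algebra_simps)
qed

section \<open>Third-order jets\<close>

text \<open>The cubic coefficient is left unspecified: it cancels on symmetric intervals.\<close>

definition jet :: "(real \<Rightarrow> real) \<Rightarrow> real \<Rightarrow> real \<Rightarrow> real \<Rightarrow> bool" where
  "jet f a b c \<longleftrightarrow> (\<exists>d. (\<lambda>t. f t - (a + b * t + c * t^2 + d * t^3)) \<in> O[nhds 0](\<lambda>t. t^4))"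

lemma isCont_imp_bigo_1:
  fixes f :: "real \<Rightarrow> real"
  assumes "isCont f 0"
  shows "f \<in> O[nhds 0](\<lambda>_. 1)"
  using assms by (intro bigoI_tendsto[where c = "f 0"])
    (auto simp: isCont_def tendsto_at_iff_tendsto_nhds)

text \<open>The power vanishes at 0, so a bound that includes this point forces
  \<open>f 0 = 0\<close>, which is exactly the information missing from \<open>at 0\<close>. The
  filter \<open>nhds 0\<close> is the convenient one for composition, since an inner function may
  take the value 0.\<close>

lemma bigo_nhds_0_iff:
  fixes f :: "real \<Rightarrow> real"
  assumes "n > 0"
  shows "f \<in> O[nhds 0](\<lambda>t. t^n) \<longleftrightarrow> f \<in> O[at 0](\<lambda>t. t^n) \<and> f 0 = 0"
proof safe
  assume *: "f \<in> O[nhds 0](\<lambda>t. t^n)"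
  then show "f \<in> O[at 0](\<lambda>t. t^n)"
    by (rule landau_o.big.filter_mono[rotated]) (simp add: at_within_def)
  from * obtain C where "eventually (\<lambda>t. norm (f t) \<le> C * norm (t^n)) (nhds 0)"
    by (elim landau_o.bigE)
  then show "f 0 = 0" using eventually_nhds_x_imp_x[of "\<lambda>t. norm (f t) \<le> C * norm (t^n)" 0] assms
    by (simp add: zero_power)
next
  assume "f \<in> O[at 0](\<lambda>t. t^n)" and 0: "f 0 = 0"
  then obtain C where "C > 0" "eventually (\<lambda>t. norm (f t) \<le> C * norm (t^n)) (at 0)"
    by (elim landau_o.bigE)
  then have "eventually (\<lambda>t. norm (f t) \<le> C * norm (t^n)) (nhds 0)"
    using 0 by (auto simp: eventually_at_filter elim!: eventually_mono)
  then show "f \<in> O[nhds 0](\<lambda>t. t^n)" by (rule bigoI)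
qed

lemma jet_cong_bigo:
  assumes "jet f a b c" "(\<lambda>t. g t - f t) \<in> O[nhds 0](\<lambda>t. t^4)"
  shows "jet g a b c"
proof -
  obtain d where "(\<lambda>t. f t - (a + b * t + c * t^2 + d * t^3)) \<in> O[nhds 0](\<lambda>t. t^4)"
    using assms by (auto simp: jet_def)
  from sum_in_bigo(1)[OF this assms(2)] show ?thesis
    unfolding jet_def by (intro exI[of _ d]) (simp add: algebra_simps)
qed

lemma jet_cong:
  assumes "jet f a b c" "eventually (\<lambda>t. f t = g t) (nhds 0)"
  shows "jet g a b c"
proof (rule jet_cong_bigo[OF assms(1)])
  have "eventually (\<lambda>t. g t - f t = 0) (nhds 0)"
    using assms(2) by eventually_elim simp
  then show "(\<lambda>t. g t - f t) \<in> O[nhds 0](\<lambda>t. t^4)"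
    by (intro bigoI[of _ 0]) (auto elim: eventually_mono)
qed

lemma jet_const: "jet (\<lambda>_. a) a 0 0"
  unfolding jet_def by (intro exI[of _ 0]) simp

lemma jet_add:
  assumes "jet f a b c" "jet g a' b' c'"
  shows "jet (\<lambda>t. f t + g t) (a + a') (b + b') (c + c')"
proof -
  obtain d d' where "(\<lambda>t. f t - (a + b * t + c * t^2 + d * t^3)) \<in> O[nhds 0](\<lambda>t. t^4)"
    "(\<lambda>t. g t - (a' + b' * t + c' * t^2 + d' * t^3)) \<in> O[nhds 0](\<lambda>t. t^4)"
    using assms by (auto simp: jet_def)
  from sum_in_bigo(1)[OF this] show ?thesis
    unfolding jet_def by (intro exI[of _ "d + d'"]) (simp add: algebra_simps)
qed

lemma jet_imp_bigo_1:
  assumes "jet f a b c"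
  shows "f \<in> O[nhds 0](\<lambda>_. 1)"
proof -
  obtain d where d: "(\<lambda>t. f t - (a + b * t + c * t^2 + d * t^3)) \<in> O[nhds 0](\<lambda>t. t^4)"
    using assms by (auto simp: jet_def)
  have "(\<lambda>t::real. t^4) \<in> O[nhds 0](\<lambda>_. 1)" "(\<lambda>t. a + b * t + c * t^2 + d * t^3) \<in> O[nhds 0](\<lambda>_. 1)"
    by (intro isCont_imp_bigo_1 continuous_intros)+
  from sum_in_bigo(1)[OF landau_o.big.trans[OF d this(1)] this(2)] show ?thesis by simp
qed

lemma jet_mult:
  assumes "jet f a b c" "jet g a' b' c'"
  shows "jet (\<lambda>t. f t * g t) (a * a') (a * b' + b * a') (a * c' + b * b' + c * a')"
proof -
  obtain d d' where d: "(\<lambda>t. f t - (a + b * t + c * t^2 + d * t^3)) \<in> O[nhds 0](\<lambda>t. t^4)"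
    and d': "(\<lambda>t. g t - (a' + b' * t + c' * t^2 + d' * t^3)) \<in> O[nhds 0](\<lambda>t. t^4)"
    using assms by (auto simp: jet_def)
  let ?P = "\<lambda>t. a + b * t + c * t^2 + d * t^3"
  have 1: "(\<lambda>t. (f t - ?P t) * g t) \<in> O[nhds 0](\<lambda>t. t^4)"
    using landau_o.big.mult[OF d jet_imp_bigo_1[OF assms(2)]] by simp
  have "?P \<in> O[nhds 0](\<lambda>_. 1)" by (intro isCont_imp_bigo_1 continuous_intros)
  from landau_o.big.mult[OF this d']
  have 2: "(\<lambda>t. ?P t * (g t - (a' + b' * t + c' * t^2 + d' * t^3))) \<in> O[nhds 0](\<lambda>t. t^4)" by simp
  \<comment> \<open>The part of degree 4 to 6 in the product of the two cubic polynomials, divided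
    by \<open>t^4\<close>.\<close>
  have "(\<lambda>t. b * d' + c * c' + d * b' + (c * d' + d * c') * t + d * d' * t^2) \<in> O[nhds 0](\<lambda>_. 1)"
    by (intro isCont_imp_bigo_1 continuous_intros)
  from landau_o.big.mult[OF this landau_o.big_refl[of "\<lambda>t. t^4"]]
  have 3: "(\<lambda>t. (b * d' + c * c' + d * b' + (c * d' + d * c') * t + d * d' * t^2) * t^4)
      \<in> O[nhds 0](\<lambda>t. t^4)" by simp
  have "f t * g t - (a * a' + (a * b' + b * a') * t + (a * c' + b * b' + c * a') * t^2
      + (a * d' + b * c' + c * b' + d * a') * t^3) =
      (f t - ?P t) * g t + ?P t * (g t - (a' + b' * t + c' * t^2 + d' * t^3))
      + (b * d' + c * c' + d * b' + (c * d' + d * c') * t + d * d' * t^2) * t^4" for t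
    by algebra
  with sum_in_bigo(1)[OF sum_in_bigo(1)[OF 1 2] 3] show ?thesis
    unfolding jet_def by (intro exI[of _ "a * d' + b * c' + c * b' + d * a'"]) simp
qed

lemma jet_cmult: "jet f a b c \<Longrightarrow> jet (\<lambda>t. k * f t) (k * a) (k * b) (k * c)"
  using jet_mult[OF jet_const] by simp

lemma jet_imp_bigo:
  assumes "jet f 0 b c"
  shows "f \<in> O[nhds 0](\<lambda>t. t)"
proof -
  obtain d where d: "(\<lambda>t. f t - (0 + b * t + c * t^2 + d * t^3)) \<in> O[nhds 0](\<lambda>t. t^4)"
    using assms by (auto simp: jet_def)
  have 1: "(\<lambda>t::real. t^3) \<in> O[nhds 0](\<lambda>_. 1)" "(\<lambda>t. b + c * t + d * t^2) \<in> O[nhds 0](\<lambda>_. 1)"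
    by (intro isCont_imp_bigo_1 continuous_intros)+
  note 2 = landau_o.big.mult[OF 1(1) landau_o.big_refl[of "\<lambda>t. t"]]
    landau_o.big.mult[OF 1(2) landau_o.big_refl[of "\<lambda>t. t"]]
  have "(\<lambda>t::real. t^4) \<in> O[nhds 0](\<lambda>t. t)"
    using 2(1) by (simp add: power_Suc2[symmetric] del: power_Suc)
  from sum_in_bigo(1)[OF landau_o.big.trans[OF d this], of "\<lambda>t. b * t + c * t^2 + d * t^3"]
  show ?thesis using 2(2) by (simp add: algebra_simps power2_eq_square power3_eq_cube)
qed

lemma bigo_id_imp_tendsto_0:
  fixes f :: "real \<Rightarrow> real"
  assumes "f \<in> O[nhds 0](\<lambda>t. t)"
  shows "(f \<longlongrightarrow> 0) (nhds 0)"
proof -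
  obtain C where "eventually (\<lambda>t. norm (f t) \<le> C * norm t) (nhds 0)"
    using assms by (elim landau_o.bigE)
  moreover have "((\<lambda>t::real. C * norm t) \<longlongrightarrow> 0) (nhds 0)"
    by (intro tendsto_eq_intros) (auto simp: filterlim_ident)
  ultimately show ?thesis by (rule Lim_null_comparison)
qed

text \<open>With zero constant term \<open>f\<close> is of order \<open>t\<close>, so the remainder
  of \<open>F\<close> stays of order \<open>t^4\<close>. The remaining polynomial in
  \<open>f\<close> is expanded by sums and products of jets, and the cube of \<open>f\<close>
  affects only the unspecified cubic coefficient.\<close>

lemma jet_compose:
  assumes F: "(\<lambda>s. F s - (k0 + k1 * s + k2 * s^2 + k3 * s^3)) \<in> O[nhds 0](\<lambda>s. s^4)"
    and f: "jet f 0 b c"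
  shows "jet (\<lambda>t. F (f t)) k0 (k1 * b) (k1 * c + k2 * b^2)"
proof -
  note o = jet_imp_bigo[OF f]
  have "(\<lambda>t. F (f t) - (k0 + k1 * f t + k2 * (f t)^2 + k3 * (f t)^3)) \<in> O[nhds 0](\<lambda>t. (f t)^4)"
    using landau_o.big.compose[OF F bigo_id_imp_tendsto_0[OF o]] .
  also have "(\<lambda>t. (f t)^4) \<in> O[nhds 0](\<lambda>t. t^4)" by (rule landau_o.big_power[OF o])
  finally have "(\<lambda>t. F (f t) - (k0 + (k1 * f t + (k2 * (f t * f t) + k3 * (f t * (f t * f t))))))
      \<in> O[nhds 0](\<lambda>t. t^4)"
    by (simp add: power2_eq_square power3_eq_cube add.assoc mult.assoc)
  moreover have "jet (\<lambda>t. k0 + (k1 * f t + (k2 * (f t * f t) + k3 * (f t * (f t * f t)))))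
      k0 (k1 * b) (k1 * c + k2 * b^2)"
    using jet_add[OF jet_const[of k0] jet_add[OF jet_cmult[OF f, of k1] jet_add[OF
      jet_cmult[OF jet_mult[OF f f], of k2] jet_cmult[OF jet_mult[OF f jet_mult[OF f f]], of k3]]]]
    by (simp add: power2_eq_square)
  ultimately show ?thesis by (rule jet_cong_bigo[rotated])
qed

lemma jet_ln_1_plus:
  assumes "jet f 0 b c"
  shows "jet (\<lambda>t. ln (1 + f t)) 0 b (c - b^2 / 2)"
proof -
  have "(\<lambda>s::real. ln (1 + s) - (0 + 1 * s + (-1/2) * s^2 + (1/3) * s^3)) \<in> O[at 0](\<lambda>s. s^4)"
    by real_asymp
  then have "(\<lambda>s::real. ln (1 + s) - (0 + 1 * s + (-1/2) * s^2 + (1/3) * s^3)) \<in> O[nhds 0](\<lambda>s. s^4)"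
    by (simp add: bigo_nhds_0_iff)
  from jet_compose[OF this assms] show ?thesis by simp
qed

lemma jet_inverse_square_1_plus:
  assumes "jet f 0 b c"
  shows "jet (\<lambda>t. 1 / (1 + f t)^2) 1 (- 2 * b) (3 * b^2 - 2 * c)"
proof -
  have "(\<lambda>s::real. 1 / (1 + s)^2 - (1 + (-2) * s + 3 * s^2 + (-4) * s^3)) \<in> O[at 0](\<lambda>s. s^4)"
    by real_asymp
  then have "(\<lambda>s::real. 1 / (1 + s)^2 - (1 + (-2) * s + 3 * s^2 + (-4) * s^3)) \<in> O[nhds 0](\<lambda>s. s^4)"
    by (simp add: bigo_nhds_0_iff)
  from jet_compose[OF this assms] show ?thesis by simp
qed

text \<open>Odd powers integrate to zero over a symmetric interval. The remainder is at most
  \<open>C * h^4\<close> on an interval of length \<open>2 * h\<close>, which gives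
  \<open>2 * C * h^5\<close>.\<close>

lemma jet_integral:
  assumes f: "jet f a b c" and cont: "continuous_on {-h0..h0} f" and "h0 > 0"
  shows "(\<lambda>h. integral {-h..h} f - (2 * a * h + 2/3 * c * h^3)) \<in> O[at_right 0](\<lambda>h. h^5)"
proof -
  obtain d where "(\<lambda>t. f t - (a + b * t + c * t^2 + d * t^3)) \<in> O[nhds 0](\<lambda>t. t^4)"
    using f by (auto simp: jet_def)
  then obtain C where C: "C > 0"
    "eventually (\<lambda>t. norm (f t - (a + b * t + c * t^2 + d * t^3)) \<le> C * norm (t^4)) (nhds 0)"
    by (elim landau_o.bigE)
  let ?P = "\<lambda>t. a + b * t + c * t^2 + d * t^3"
  obtain r where r: "r > 0" "\<And>t. \<bar>t\<bar> < r \<Longrightarrow> \<bar>f t - ?P t\<bar> \<le> C * t^4"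
    using C(2) by (auto simp: eventually_nhds_metric dist_real_def)
  have "norm (integral {-h..h} f - (2 * a * h + 2/3 * c * h^3)) \<le> 2 * C * norm (h^5)"
    if h: "h > 0" "h < min r h0" for h
  proof -
    let ?Q = "\<lambda>t. a * t + b / 2 * t^2 + c / 3 * t^3 + d / 4 * t^4"
    have "(?P has_integral (?Q h - ?Q (-h))) {-h..h}"
      using h by (intro fundamental_theorem_of_calculus)
        (auto intro!: derivative_eq_intros
          simp flip: has_real_derivative_iff_has_vector_derivative)
    moreover have "?Q h - ?Q (-h) = 2 * a * h + 2/3 * c * h^3" by simp
    ultimately have P: "(?P has_integral (2 * a * h + 2/3 * c * h^3)) {-h..h}" by metis
    have fi: "f integrable_on {-h..h}"
      using h by (intro integrable_continuous_real continuous_on_subset[OF cont]) auto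
    have "norm (integral {-h..h} (\<lambda>t. f t - ?P t)) \<le> integral {-h..h} (\<lambda>_. C * h^4)"
    proof (rule integral_norm_bound_integral)
      fix t assume t: "t \<in> {-h..h}"
      then have "\<bar>t\<bar> \<le> h" by auto
      then have "\<bar>t\<bar>^4 \<le> h^4" by (intro power_mono) auto
      then have "C * t^4 \<le> C * h^4" using C(1) by simp
      then show "norm (f t - ?P t) \<le> C * h^4"
        using r(2)[of t] h \<open>\<bar>t\<bar> \<le> h\<close> by auto
    qed (use fi P in \<open>auto intro!: integrable_diff\<close>)
    moreover have "integral {-h..h} (\<lambda>t. f t - ?P t) = integral {-h..h} f - (2 * a * h + 2/3 * c * h^3)"
      using fi P by (simp add: integral_diff has_integral_integrable integral_unique)
    moreover have "integral {-h..h} (\<lambda>_. C * h^4) = 2 * C * h^5"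
      using h by (simp add: eval_nat_numeral)
    moreover have "norm (h^5) = h^5" using h by simp
    ultimately show ?thesis by (simp only:)
  qed
  moreover have "eventually (\<lambda>h. h > 0 \<and> h < min r h0) (at_right 0)"
    using r(1) assms(3) by (auto simp: eventually_at_right_field intro!: exI[of _ "min r h0"])
  ultimately show ?thesis
    by (intro bigoI[of _ "2 * C"]) (auto elim!: eventually_mono)
qed

section \<open>The thickness function and the energy\<close>

text \<open>The volume constraint says that \<open>?q\<close> squares to 1. Being continuous on an
  interval, \<open>?q\<close> is constant, and \<open>p' 0 > 0\<close> selects the value 1. The
  second claim integrates the first.\<close>

lemma implicit_thickness:
  fixes p p' :: "real \<Rightarrow> real"
  assumes h0: "h0 > 0"
    and der: "\<And>t. t \<in> {-h0..h0} \<Longrightarrow> (p has_real_derivative p' t) (at t within {-h0..h0})"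
    and cont: "continuous_on {-h0..h0} p'"
    and p0: "p 0 = 0" and p'0: "p' 0 > 0"
    and vol: "\<And>t. t \<in> {-h0..h0} \<Longrightarrow> (1 + 2 * H * p t + K * (p t)^2)^2 * (p' t)^2 = 1"
    and t: "t \<in> {-h0..h0}"
  shows "(1 + 2 * H * p t + K * (p t)^2) * p' t = 1"
    and "p t + H * (p t)^2 + K / 3 * (p t)^3 = t"
proof -
  let ?I = "{-h0..h0}"
  let ?q = "\<lambda>t. (1 + 2 * H * p t + K * (p t)^2) * p' t"
  have contp: "continuous_on ?I p"
    using der by (intro DERIV_continuous_on) auto
  have sq: "?q t = 1 \<or> ?q t = -1" if "t \<in> ?I" for t
    using vol[OF that] by (simp add: power2_eq_1_iff flip: power_mult_distrib)
  have "?q constant_on ?I"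
  proof (rule continuous_finite_range_constant)
    show "continuous_on ?I ?q" by (intro continuous_intros contp cont)
    show "finite (?q ` ?I)" by (rule finite_subset[of _ "{1, -1}"]) (use sq in blast, simp)
  qed auto
  then have "?q t = ?q 0" if "t \<in> ?I" for t
    using that h0 unfolding constant_on_def by (metis atLeastAtMost_iff less_imp_le neg_le_0_iff_le)
  moreover have "?q 0 = 1" using sq[of 0] h0 p0 p'0 by auto
  ultimately have q: "?q t = 1" if "t \<in> ?I" for t using that by metis
  show "?q t = 1" by (rule q[OF t])
  \<comment> \<open>The derivative of \<open>?F\<close> is \<open>?q t - 1\<close>, hence
    zero.\<close>
  let ?F = "\<lambda>t. p t + H * (p t)^2 + K / 3 * (p t)^3 - t"
  have "(?F has_real_derivative 0) (at t within ?I)" if "t \<in> ?I" for t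
    using q[OF that]
    by (auto intro!: derivative_eq_intros der[OF that] simp: algebra_simps power2_eq_square)
  then have "\<exists>c. \<forall>t\<in>?I. ?F t = c"
    by (intro has_field_derivative_zero_constant) auto
  then obtain c where "\<And>s. s \<in> ?I \<Longrightarrow> ?F s = c" by blast
  from this[OF t] this[of 0] have "?F t = ?F 0" using h0 by simp
  then show "p t + H * (p t)^2 + K / 3 * (p t)^3 = t" using p0 by simp
qed

text \<open>Each substitution of the expansion into the right-hand side of
  \<open>p = t - H p\<^sup>2 - K p\<^sup>3 / 3\<close> gains one order.\<close>

lemma series_reversion_cubic:
  fixes p :: "real \<Rightarrow> real"
  assumes p: "p \<in> O[nhds 0](\<lambda>t. t)"
    and eq: "eventually (\<lambda>t. p t + H * (p t)^2 + K / 3 * (p t)^3 = t) (nhds 0)"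
  shows "(\<lambda>t. p t - (t - H * t^2 + 1/3 * (6 * H^2 - K) * t^3)) \<in> O[nhds 0](\<lambda>t. t^4)"
proof -
  \<comment> \<open>Estimates may be transferred between expressions that agree wherever the
    implicit equation holds.\<close>
  have conv: "f \<in> O[nhds 0](\<lambda>t. t^n)"
    if "g \<in> O[nhds 0](\<lambda>t. t^n)" "\<And>t. p t + H * (p t)^2 + K / 3 * (p t)^3 = t \<Longrightarrow> f t = g t"
    for f g :: "real \<Rightarrow> real" and n
  proof -
    have "eventually (\<lambda>t. f t = g t) (nhds 0)"
      by (rule eventually_mono[OF eq]) (rule that(2))
    from landau_o.big.in_cong[OF this] that(1) show ?thesis by blast
  qed
  have pow: "(\<lambda>t. (p t)^2) \<in> O[nhds 0](\<lambda>t. t^2)" "(\<lambda>t. (p t)^3) \<in> O[nhds 0](\<lambda>t. t^3)"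
    by (intro landau_o.big_power p)+
  have up: "f \<in> O[nhds 0](\<lambda>t. t^n)" if "f \<in> O[nhds 0](\<lambda>t. t^Suc n)"
    for f :: "real \<Rightarrow> real" and n
  proof -
    have "(\<lambda>t::real. t) \<in> O[nhds 0](\<lambda>_. 1)" by (intro isCont_imp_bigo_1 continuous_intros)
    from landau_o.big.mult[OF this landau_o.big_refl[of "\<lambda>t. t^n"]]
    have "(\<lambda>t::real. t^Suc n) \<in> O[nhds 0](\<lambda>t. t^n)" by simp
    with that show ?thesis by (rule landau_o.big.trans)
  qed
  have lin: "(\<lambda>t. k * f t) \<in> O[nhds 0](\<lambda>t. t^n)" if "f \<in> O[nhds 0](\<lambda>t. t^n)"
    for f :: "real \<Rightarrow> real" and k n
    using that by simp
  have id: "(\<lambda>t. t) \<in> O[nhds 0](\<lambda>t::real. t)" by simp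
  have o2: "(\<lambda>t. p t - t) \<in> O[nhds 0](\<lambda>t. t^2)"
  proof (rule conv)
    show "(\<lambda>t. (- H) * (p t)^2 + (- K / 3) * (p t)^3) \<in> O[nhds 0](\<lambda>t. t^2)"
      using pow(2) by (intro sum_in_bigo lin pow(1) up[of _ 2]) (simp add: eval_nat_numeral)
  qed auto
  have sum1: "(\<lambda>t. p t + t) \<in> O[nhds 0](\<lambda>t. t)" by (intro sum_in_bigo p id)
  have sq3: "(\<lambda>t. (p t)^2 - t^2) \<in> O[nhds 0](\<lambda>t. t^3)"
  proof -
    have "(\<lambda>t. (p t - t) * (p t + t)) \<in> O[nhds 0](\<lambda>t. t^2 * t)"
      by (rule landau_o.big.mult[OF o2 sum1])
    moreover have "(\<lambda>t. (p t - t) * (p t + t)) = (\<lambda>t. (p t)^2 - t^2)"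
      by (simp add: fun_eq_iff algebra_simps power2_eq_square)
    ultimately show ?thesis by (simp add: power3_eq_cube power2_eq_square)
  qed
  have cub4: "(\<lambda>t. (p t)^3 - t^3) \<in> O[nhds 0](\<lambda>t. t^4)"
  proof -
    have pt: "(\<lambda>t. p t * t) \<in> O[nhds 0](\<lambda>t. t^2)"
      using landau_o.big.mult[OF p id] by (simp add: power2_eq_square)
    have "(\<lambda>t. (p t)^2 + p t * t + t^2) \<in> O[nhds 0](\<lambda>t. t^2)"
      by (intro sum_in_bigo pow(1) pt) simp
    from landau_o.big.mult[OF o2 this]
    have "(\<lambda>t. (p t - t) * ((p t)^2 + p t * t + t^2)) \<in> O[nhds 0](\<lambda>t. t^2 * t^2)" .
    moreover have "(\<lambda>t. (p t - t) * ((p t)^2 + p t * t + t^2)) = (\<lambda>t. (p t)^3 - t^3)"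
      by (simp add: fun_eq_iff algebra_simps power2_eq_square power3_eq_cube)
    ultimately show ?thesis by (simp flip: power_add)
  qed
  have o3: "(\<lambda>t. p t - (t - H * t^2)) \<in> O[nhds 0](\<lambda>t. t^3)"
  proof (rule conv)
    show "(\<lambda>t. (- H) * ((p t)^2 - t^2) + (- K / 3) * (p t)^3) \<in> O[nhds 0](\<lambda>t. t^3)"
      by (intro sum_in_bigo lin sq3 pow(2))
  qed (auto simp: algebra_simps)
  have sq4: "(\<lambda>t. (p t)^2 - (t - H * t^2)^2) \<in> O[nhds 0](\<lambda>t. t^4)"
  proof -
    have "(\<lambda>t. (t - H * t^2)) \<in> O[nhds 0](\<lambda>t. t)"
    proof -
      have "(\<lambda>t. 1 - H * t) \<in> O[nhds 0](\<lambda>_. 1)" by (intro isCont_imp_bigo_1 continuous_intros)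
      from landau_o.big.mult[OF this id] show ?thesis by (simp add: algebra_simps power2_eq_square)
    qed
    then have "(\<lambda>t. p t + (t - H * t^2)) \<in> O[nhds 0](\<lambda>t. t)" by (rule sum_in_bigo(1)[OF p])
    from landau_o.big.mult[OF o3 this]
    have "(\<lambda>t. (p t - (t - H * t^2)) * (p t + (t - H * t^2))) \<in> O[nhds 0](\<lambda>t. t^3 * t)" .
    moreover have "(\<lambda>t. (p t - (t - H * t^2)) * (p t + (t - H * t^2))) = (\<lambda>t. (p t)^2 - (t - H * t^2)^2)"
      by (simp add: fun_eq_iff algebra_simps power2_eq_square)
    ultimately show ?thesis by (simp add: power_Suc2[symmetric] del: power_Suc)
  qed
  show ?thesis
  proof (rule conv)
    \<comment> \<open>The last term cancels the quartic part of \<open>H * (t - H * t^2)^2\<close>;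
      the quadratic and cubic parts produce the stated coefficients.\<close>
    show "(\<lambda>t. (- H) * ((p t)^2 - (t - H * t^2)^2) + (- K / 3) * ((p t)^3 - t^3) + (-(H^3)) * t^4)
        \<in> O[nhds 0](\<lambda>t. t^4)"
      by (intro sum_in_bigo lin sq4 cub4) simp
    show "p t - (t - H * t^2 + 1/3 * (6 * H^2 - K) * t^3) =
        (- H) * ((p t)^2 - (t - H * t^2)^2) + (- K / 3) * ((p t)^3 - t^3) + (-(H^3)) * t^4"
      if "p t + H * (p t)^2 + K / 3 * (p t)^3 = t" for t
    proof -
      have "p t = t - H * (p t)^2 - K / 3 * (p t)^3" using that by simp
      then have "p t - (t - H * t^2 + 1/3 * (6 * H^2 - K) * t^3) =
        - H * (p t)^2 - K / 3 * (p t)^3 + H * t^2 - 1/3 * (6 * H^2 - K) * t^3" by linarith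
      also have "\<dots> = (- H) * ((p t)^2 - (t - H * t^2)^2) + (- K / 3) * ((p t)^3 - t^3) + (-(H^3)) * t^4"
        by (simp add: field_simps eval_nat_numeral)
      finally show ?thesis .
    qed
  qed
qed

lemma DERIV_imp_bigo_id:
  fixes p :: "real \<Rightarrow> real"
  assumes "(p has_real_derivative d) (at 0)" "p 0 = 0"
  shows "p \<in> O[nhds 0](\<lambda>t. t)"
proof -
  have "((\<lambda>t. p t / t) \<longlongrightarrow> d) (at 0)"
    using assms by (simp add: has_field_derivative_iff)
  then have "p \<in> O[at 0](\<lambda>t. t)"
    by (rule bigoI_tendsto) (simp add: eventually_at_filter)
  then show ?thesis using bigo_nhds_0_iff[of 1 p] assms(2) by simp
qed

text \<open>The argument of the logarithm factors as \<open>(D / J) * (1 - u t / D)\<close>, where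
  \<open>u\<close> is the first invariant minus its value \<open>a + 1\<close> at 0. The jet of
  \<open>u\<close> then passes through the expansion of \<open>ln (1 + s)\<close>.\<close>

lemma gent_energy_jet:
  fixes p p' :: "real \<Rightarrow> real" and a H K T J \<mu> :: real
  defines "D \<equiv> J - (a - 2)"
  assumes p: "(\<lambda>t. p t - (t - H * t^2 + 1/3 * (6 * H^2 - K) * t^3)) \<in> O[nhds 0](\<lambda>t. t^4)"
    and p': "eventually (\<lambda>t. (1 + 2 * H * p t + K * (p t)^2) * p' t = 1) (nhds 0)"
    and J: "J > 0" "D > 0"
  shows "jet (\<lambda>t. - (\<mu> / 2) * J *
      ln (1 - (a + 2 * T * p t + (2 * H * T - K * a) * (p t)^2 + (p' t)^2 - 3) / J))
    (- (\<mu> / 2) * J * ln (D / J)) (\<mu> * J * (T - 2 * H) / D)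
    (\<mu> / 2 * J * (2 * ((T - 2 * H) / D)^2 + (16 * H^2 - K * (a + 2)) / D))"
proof -
  have jp: "jet p 0 1 (- H)"
    unfolding jet_def using p by (intro exI[of _ "1/3 * (6 * H^2 - K)"]) simp
  have jp2: "jet (\<lambda>t. (p t)^2) 0 0 1"
    using jet_mult[OF jp jp] by (simp add: power2_eq_square)
  have "jet (\<lambda>t. 2 * H * p t + K * (p t)^2) 0 (2 * H) (K - 2 * H^2)"
    using jet_add[OF jet_cmult[OF jp, of "2 * H"] jet_cmult[OF jp2, of K]]
    by (simp add: power2_eq_square algebra_simps)
  from jet_inverse_square_1_plus[OF this]
  have "jet (\<lambda>t. 1 / (1 + (2 * H * p t + K * (p t)^2))^2) 1 (- 4 * H) (16 * H^2 - 2 * K)"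
    by (simp add: power2_eq_square algebra_simps)
  \<comment> \<open>The constraint expresses \<open>p'\<close> through \<open>p\<close>. A remainder
    estimate for \<open>p\<close> could not simply be differentiated.\<close>
  then have jp': "jet (\<lambda>t. (p' t)^2) 1 (- 4 * H) (16 * H^2 - 2 * K)"
  proof (rule jet_cong)
    show "eventually (\<lambda>t. 1 / (1 + (2 * H * p t + K * (p t)^2))^2 = (p' t)^2) (nhds 0)"
      using p'
    proof eventually_elim
      case (elim t)
      then have "1 + (2 * H * p t + K * (p t)^2) \<noteq> 0" by (auto simp: add.assoc)
      with elim have "p' t = 1 / (1 + (2 * H * p t + K * (p t)^2))"
        by (intro eq_divide_imp) (auto simp: algebra_simps)
      then show ?case by (simp add: power_divide)
    qed
  qed
  define u where "u = (\<lambda>t. 2 * T * p t + (2 * H * T - K * a) * (p t)^2 + (p' t)^2 + (-1))"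
  \<comment> \<open>In the quadratic coefficient \<open>- 2 * H * T\<close> from the linear term in
    \<open>p\<close> cancels \<open>2 * H * T\<close> from the quadratic one.\<close>
  have "jet u 0 (2 * (T - 2 * H)) (16 * H^2 - K * (a + 2))"
    using jet_add[OF jet_add[OF jet_add[OF jet_cmult[OF jp, of "2 * T"]
      jet_cmult[OF jp2, of "2 * H * T - K * a"]] jp'] jet_const[of "-1"]]
    by (simp add: u_def algebra_simps)
  from jet_ln_1_plus[OF jet_cmult[OF this, of "- 1 / D", simplified mult_zero_right]]
  have ln: "jet (\<lambda>t. ln (1 + (- 1 / D) * u t)) 0 (- 1 / D * (2 * (T - 2 * H)))
      (- 1 / D * (16 * H^2 - K * (a + 2)) - (- 1 / D * (2 * (T - 2 * H)))^2 / 2)" .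
  have "jet (\<lambda>t. - (\<mu> / 2) * J * (ln (D / J) + ln (1 + (- 1 / D) * u t)))
    (- (\<mu> / 2) * J * ln (D / J)) (\<mu> * J * (T - 2 * H) / D)
    (\<mu> / 2 * J * (2 * ((T - 2 * H) / D)^2 + (16 * H^2 - K * (a + 2)) / D))"
  proof -
    have 1: "- (\<mu> / 2) * J * (0 + (- 1 / D * (2 * (T - 2 * H)))) = \<mu> * J * (T - 2 * H) / D"
      using J by (simp add: field_simps)
    have 2: "- (\<mu> / 2) * J * (0 + (- 1 / D * (16 * H^2 - K * (a + 2)) - (- 1 / D * (2 * (T - 2 * H)))^2 / 2))
      = \<mu> / 2 * J * (2 * ((T - 2 * H) / D)^2 + (16 * H^2 - K * (a + 2)) / D)"
      using J by (simp add: divide_simps) (simp add: algebra_simps power2_eq_square)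
    show ?thesis
      using jet_cmult[OF jet_add[OF jet_const[of "ln (D / J)"] ln], of "- (\<mu> / 2) * J"]
      unfolding 1 2 by simp
  qed
  then show ?thesis
  proof (rule jet_cong)
    have "(u \<longlongrightarrow> 0) (nhds 0)"
      using bigo_id_imp_tendsto_0[OF jet_imp_bigo] \<open>jet u 0 _ _\<close> by blast
    \<comment> \<open>This makes both factors positive, so the logarithm of the product
      splits.\<close>
    then have "eventually (\<lambda>t. u t < D) (nhds 0)"
      using J by (intro order_tendstoD)
    then show "eventually (\<lambda>t. - (\<mu> / 2) * J * (ln (D / J) + ln (1 + (- 1 / D) * u t)) =
      - (\<mu> / 2) * J * ln (1 - (a + 2 * T * p t + (2 * H * T - K * a) * (p t)^2 + (p' t)^2 - 3) / J))
      (nhds 0)"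
    proof eventually_elim
      case (elim t)
      then have "0 < 1 + (- 1 / D) * u t" using J by (simp add: field_simps)
      then have "ln (D / J) + ln (1 + (- 1 / D) * u t) = ln ((D / J) * (1 + (- 1 / D) * u t))"
        using J by (intro ln_mult_pos[symmetric]) auto
      also have "(D / J) * (1 + (- 1 / D) * u t) =
          1 - (a + 2 * T * p t + (2 * H * T - K * a) * (p t)^2 + (p' t)^2 - 3) / J"
        using J by (simp add: field_simps) (simp add: u_def D_def algebra_simps)
      finally show ?case by simp
    qed
  qed
qed

theorem proposition6:
  fixes S :: "(real^2) set" and y :: "real^2 \<Rightarrow> real^3"
    and \<phi> :: "real^2 \<Rightarrow> real \<Rightarrow> real" and h0 \<mu> J\<^sub>m :: real
  assumes "open S" and "connected S" and "bounded S" and "S \<noteq> {}"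
    and "h0 > 0" and "\<mu> > 0" and "J\<^sub>m > 0"
    and "C3_immersion_closure S y" and "inj_on y (closure S)"
    and "\<forall>x\<in>closure S. Ck_interval 3 {-h0..h0} (\<phi> x)"
    and "\<forall>x\<in>closure S. \<phi> x 0 = 0"
    and "\<forall>x\<in>closure S. deriv3 h0 \<phi> x 0 > 0"
    and "\<forall>x\<in>closure S. det (C0 S y x) = 1"
    and "\<forall>x\<in>closure S. \<forall>t\<in>{-h0..h0}. det (C_f S y h0 \<phi> x t) = 1"
    and "\<forall>x\<in>closure S. \<forall>t\<in>{-h0..h0}. trace (C_f S y h0 \<phi> x t) < J\<^sub>m + 3"
  shows "\<forall>x\<in>closure S.
      (\<lambda>t. \<phi> x t - (t - mean_curvature S y x * t^2
             + 1/3 * (6 * (mean_curvature S y x)^2 - gauss_curvature S y x) * t^3))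
        \<in> O[at 0](\<lambda>t. t^4)
    \<and> (\<lambda>h. integral {-h..h} (\<lambda>t. W_G \<mu> J\<^sub>m (C_f S y h0 \<phi> x t))
             - (h * w_s \<mu> J\<^sub>m S y x + h^3 * w_b \<mu> J\<^sub>m S y x))
        \<in> O[at_right 0](\<lambda>h. h^5)"
proof (intro ballI)
  fix x assume x: "x \<in> closure S"
  define H where "H = mean_curvature S y x"
  define K where "K = gauss_curvature S y x"
  define T where "T = tr_B_curv S y x"
  define a where "a = trace (C0 S y x)"
  let ?I = "{-h0..h0}"
  let ?p = "\<phi> x" and ?p' = "deriv3 h0 \<phi> x"
  let ?W = "\<lambda>t. W_G \<mu> J\<^sub>m (C_f S y h0 \<phi> x t)"
  have h0: "h0 > 0" and J: "J\<^sub>m > 0" by fact+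
  have nhds: "eventually (\<lambda>t. t \<in> {-h0<..<h0}) (nhds 0)"
    using h0 by (intro eventually_nhds_in_open) auto
  obtain q where q: "\<And>t. t \<in> ?I \<Longrightarrow> (?p has_real_derivative q t) (at t within ?I)"
    and Cq: "Ck_interval 2 ?I q"
    using assms(10) x unfolding numeral_3_eq_3 numeral_2_eq_2 Ck_interval.simps(2)[of "Suc (Suc 0)"]
    by blast
  have p'_eq: "?p' t = q t" if "t \<in> ?I" for t
    using q[OF that] h0 that unfolding deriv3_def has_real_derivative_iff_has_vector_derivative
    by (intro vector_derivative_within_closed_interval) auto
  have contq: "continuous_on ?I q"
    using Cq unfolding numeral_2_eq_2 Ck_interval.simps(2)[of "Suc 0"]
    by (blast intro: DERIV_continuous_on)
  have contp: "continuous_on ?I ?p"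
    using q by (rule DERIV_continuous_on)
  have contp': "continuous_on ?I ?p'"
    using contq by (rule continuous_on_eq) (simp add: p'_eq)
  have der: "(?p has_real_derivative ?p' t) (at t within ?I)" if "t \<in> ?I" for t
    using q[OF that] p'_eq[OF that] by simp
  have p0: "?p 0 = 0" and p'0: "?p' 0 > 0" using assms(11,12) x by auto
  note inv = strain_invariants[OF assms(1,8) x, of h0 \<phi>, folded H_def K_def T_def a_def]
  \<comment> \<open>With \<open>det (C0 S y x) = 1\<close> the incompressibility of
    \<open>C_f\<close> becomes a condition on the thickness function alone.\<close>
  have vol: "(1 + 2 * H * ?p t + K * (?p t)^2)^2 * (?p' t)^2 = 1" if "t \<in> ?I" for t
    using assms(13,14) x that inv(1)[of t] by simp
  note thick = implicit_thickness[OF h0 der contp' p0 p'0 vol]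
  have "(?p has_real_derivative ?p' 0) (at 0)"
    using der[of 0] h0 at_within_Icc_at[of "-h0" 0 h0] by simp
  note o = DERIV_imp_bigo_id[OF this p0]
  have exp: "(\<lambda>t. ?p t - (t - H * t^2 + 1/3 * (6 * H^2 - K) * t^3)) \<in> O[nhds 0](\<lambda>t. t^4)"
    by (rule series_reversion_cubic[OF o eventually_mono[OF nhds thick(2)]]) auto
  have tr: "a + 2 * T * ?p t + (2 * H * T - K * a) * (?p t)^2 + (?p' t)^2 < J\<^sub>m + 3" if "t \<in> ?I" for t
    unfolding inv(2)[symmetric] using assms(15) x that by blast
  have p'0_eq: "?p' 0 = 1" using thick(1)[of 0] h0 p0 by simp
  \<comment> \<open>At \<open>t = 0\<close> the first invariant equals \<open>a + 1\<close>, so its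
    assumed bound is precisely this inequality.\<close>
  have D: "J\<^sub>m - (a - 2) > 0" using tr[of 0] h0 p0 p'0_eq by simp
  have W: "?W = (\<lambda>t. - (\<mu> / 2) * J\<^sub>m *
      ln (1 - (a + 2 * T * ?p t + (2 * H * T - K * a) * (?p t)^2 + (?p' t)^2 - 3) / J\<^sub>m))"
    by (simp add: W_G_def inv(2))
  have "jet ?W (- (\<mu> / 2) * J\<^sub>m * ln ((J\<^sub>m - (a - 2)) / J\<^sub>m)) (\<mu> * J\<^sub>m * (T - 2 * H) / (J\<^sub>m - (a - 2)))
    (\<mu> / 2 * J\<^sub>m * (2 * ((T - 2 * H) / (J\<^sub>m - (a - 2)))^2 + (16 * H^2 - K * (a + 2)) / (J\<^sub>m - (a - 2))))"
    unfolding W using thick(1) nhds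
    by (intro gent_energy_jet exp J D) (auto elim!: eventually_mono)
  \<comment> \<open>The bound on the first invariant keeps the argument of the logarithm positive on
    the whole interval.\<close>
  moreover have "continuous_on ?I ?W"
    unfolding W using J tr
    by (intro continuous_intros contp contp') (fastforce simp: field_simps)+
  ultimately have "(\<lambda>h. integral {-h..h} ?W
      - (2 * (- (\<mu> / 2) * J\<^sub>m * ln ((J\<^sub>m - (a - 2)) / J\<^sub>m)) * h
      + 2/3 * (\<mu> / 2 * J\<^sub>m * (2 * ((T - 2 * H) / (J\<^sub>m - (a - 2)))^2
          + (16 * H^2 - K * (a + 2)) / (J\<^sub>m - (a - 2)))) * h^3)) \<in> O[at_right 0](\<lambda>h. h^5)"
    by (rule jet_integral[OF _ _ h0])
  moreover have "2 * (- (\<mu> / 2) * J\<^sub>m * ln ((J\<^sub>m - (a - 2)) / J\<^sub>m)) = w_s \<mu> J\<^sub>m S y x"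
    using J by (simp add: w_s_def a_def diff_divide_distrib)
  moreover have "2/3 * (\<mu> / 2 * J\<^sub>m * (2 * ((T - 2 * H) / (J\<^sub>m - (a - 2)))^2
          + (16 * H^2 - K * (a + 2)) / (J\<^sub>m - (a - 2)))) = w_b \<mu> J\<^sub>m S y x"
    by (simp add: w_b_def H_def K_def T_def a_def)
  ultimately have "(\<lambda>h. integral {-h..h} ?W - (h * w_s \<mu> J\<^sub>m S y x + h^3 * w_b \<mu> J\<^sub>m S y x))
      \<in> O[at_right 0](\<lambda>h. h^5)"
    by (simp only: mult.commute)
  moreover have "(\<lambda>t. ?p t - (t - H * t^2 + 1/3 * (6 * H^2 - K) * t^3)) \<in> O[at 0](\<lambda>t. t^4)"
    using exp by (simp only: bigo_nhds_0_iff zero_less_numeral)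
  ultimately show "(\<lambda>t. \<phi> x t - (t - mean_curvature S y x * t^2
             + 1/3 * (6 * (mean_curvature S y x)^2 - gauss_curvature S y x) * t^3))
        \<in> O[at 0](\<lambda>t. t^4)
    \<and> (\<lambda>h. integral {-h..h} (\<lambda>t. W_G \<mu> J\<^sub>m (C_f S y h0 \<phi> x t))
             - (h * w_s \<mu> J\<^sub>m S y x + h^3 * w_b \<mu> J\<^sub>m S y x))
        \<in> O[at_right 0](\<lambda>h. h^5)"
    unfolding H_def K_def by blast
qed

end
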